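(* For $n\ge 5$ define $B(n)=\frac{n^2}{2}-\frac{n}{4}$ if $n\equiv 0\pmod 4$; $B(n)=\frac{n^2}{2}-\frac{n}{4}-\frac14$ if $n\equiv 1\pmod 4$; $B(n)=\frac{n^2}{2}-\frac{n}{4}-\frac12$ if $n\equiv 2\pmod 4$; $B(n)=\frac{n^2}{2}-\frac{n}{4}-\frac34$ if $n\equiv 3\pmod 8$; and $B(n)=\frac{n^2}{2}-\frac{n}{4}+\frac14$ if $n\equiv 7\pmod 8$. (Every winning path on the $n\times n$ board has length at most $B(n)$.) Then for every $n\ge 5$ with $n\ne 9$ there exists a winning path on the $n\times n$ Hex board of length exactly $B(n)$, whereas for $n=9$ there is no winning path of length $B(9)=38$.
   Context: The $n\times n$ Hex board has cells $(x,y)$ with $x,y\in\{1,\dots,n\}$. Two cells $(x,y),(x',y')$ are adjacent iff $(x'-x,y'-y)\in\{(\pm1,0),(0,\pm1),(1,-1),(-1,1)\}$. Row $1$ is the top edge and row $n$ the bottom edge. A winning connection is a set $S$ of cells containing a subset that is connected under adjacency and meets both row $1$ and row $n$. A winning path is an inclusion-minimal winning connection; its length is its number of cells. *)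

theory Defs
  imports Complex_Main
begin

type_synonym cell = "int \<times> int"

definition hex_board :: "nat \<Rightarrow> cell set" where
  "hex_board n = {1..int n} \<times> {1..int n}"

definition hex_adj :: "cell rel" where
  "hex_adj = {((x, y), (x', y')). (x' - x, y' - y) \<in>
     {(1, 0), (-1, 0), (0, 1), (0, -1), (1, -1), (-1, 1)}}"

definition hex_connected :: "cell set \<Rightarrow> bool" where
  "hex_connected T \<longleftrightarrow> (\<forall>p\<in>T. \<forall>q\<in>T. (p, q) \<in> (Restr hex_adj T)\<^sup>*)"

text \<open>The second coordinate is the row number. The choice is immaterial, because the board and the
  adjacency relation are invariant under swapping the two coordinates.\<close>

definition hex_row :: "nat \<Rightarrow> nat \<Rightarrow> cell set" where
  "hex_row n r = {(x, y) \<in> hex_board n. y = int r}"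

definition winning_connection :: "nat \<Rightarrow> cell set \<Rightarrow> bool" where
  "winning_connection n S \<longleftrightarrow> S \<subseteq> hex_board n \<and>
     (\<exists>T\<subseteq>S. hex_connected T \<and> T \<inter> hex_row n 1 \<noteq> {} \<and> T \<inter> hex_row n n \<noteq> {})"

definition winning_path :: "nat \<Rightarrow> cell set \<Rightarrow> bool" where
  "winning_path n S \<longleftrightarrow> winning_connection n S \<and> (\<forall>S'. S' \<subset> S \<longrightarrow> \<not> winning_connection n S')"

text \<open>The last case is \<open>n mod 8 = 7\<close>. Only \<open>n \<ge> 5\<close> is meant.\<close>

definition hex_bound :: "nat \<Rightarrow> real" where
  "hex_bound n =
    (if n mod 4 = 0 then (real n)\<^sup>2 / 2 - real n / 4
     else if n mod 4 = 1 then (real n)\<^sup>2 / 2 - real n / 4 - 1 / 4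
     else if n mod 4 = 2 then (real n)\<^sup>2 / 2 - real n / 4 - 1 / 2
     else if n mod 8 = 3 then (real n)\<^sup>2 / 2 - real n / 4 - 3 / 4
     else (real n)\<^sup>2 / 2 - real n / 4 + 1 / 4)"

end

theory Submission
  imports Defs
begin

text \<open>A winning path is an induced path of the triangular lattice that meets the rows \<open>1\<close> and \<open>n\<close>
  only in its ends. A triangle of the lattice contains at most two cells of it, and if two then
  consecutive ones. Cut the board along the antidiagonal \<open>x + y = n + 1\<close>. In the half that
  contains \<open>(1, 1)\<close> take the triangles \<open>{(x, y), (x - 1, y + 1), (x, y + 1)}\<close>, and in the other half
  their images under the rotation by 180 degrees. Counting the triangles that are met by a path of
  length \<open>k\<close> gives \<open>2 k = n\<^sup>2 - n + 3 + r - e\<^sub>1 - e\<^sub>2\<close>, where \<open>e\<^sub>1\<close> and \<open>e\<^sub>2\<close> are the numbers of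
  triangles that are missed in the halves, and \<open>r \<le> (n - 1) / 2\<close> is the number of runs of the path on
  the antidiagonal, corrected at its end points. Near the corners \<open>(1, 1)\<close> and \<open>(n, n)\<close>, where the
  board has an angle of 60 degrees, some triangle is always missed, so \<open>e\<^sub>1, e\<^sub>2 \<ge> 1\<close>. This is the
  bound except for \<open>n \<equiv> 3 (mod 8)\<close>.

  If \<open>n\<close> is odd and \<open>r = (n - 1) / 2\<close>, then the path crosses the antidiagonal at every second cell, so
  the number of crossings is odd, and the count in a single half becomes a parity condition that
  excludes \<open>e\<^sub>1 = e\<^sub>2 = 1\<close> for \<open>n \<equiv> 3 (mod 8)\<close>. For \<open>n = 9\<close> and \<open>k = 38\<close> this leaves \<open>r = 3\<close> and
  \<open>e\<^sub>1 = e\<^sub>2 = 1\<close>, and then the possible patterns on the antidiagonal are too asymmetric to occur for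
  both halves.

  Conversely, a path of maximal length on the board of side \<open>n\<close> becomes one on the board of side
  \<open>n + 8\<close> when its ends are continued in a ring of width \<open>4\<close> around the board.\<close>

section \<open>Induced paths\<close>

lemma hex_adj_iff:
  "((x, y), (x', y')) \<in> hex_adj \<longleftrightarrow>
     x' = x + 1 \<and> y' = y \<or> x' = x - 1 \<and> y' = y \<or> x' = x \<and> y' = y + 1 \<or> x' = x \<and> y' = y - 1 \<or>
     x' = x + 1 \<and> y' = y - 1 \<or> x' = x - 1 \<and> y' = y + 1"
  by (simp only: hex_adj_def mem_Collect_eq prod.case insert_iff prod.inject empty_iff) presburger

lemma hex_adj_sym: "(p, q) \<in> hex_adj \<Longrightarrow> (q, p) \<in> hex_adj"
  by (cases p; cases q) (auto simp: hex_adj_iff)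

lemma hex_adj_irrefl: "(p, p) \<notin> hex_adj"
  by (cases p) (auto simp: hex_adj_iff)

lemma mem_hex_row_iff: "p \<in> hex_row n r \<longleftrightarrow> p \<in> hex_board n \<and> snd p = int r"
  by (cases p) (auto simp: hex_row_def)

fun induced_path :: "cell list \<Rightarrow> bool" where
  "induced_path [] = True"
| "induced_path [p] = True"
| "induced_path (p # q # ps) =
     ((p, q) \<in> hex_adj \<and> (\<forall>r\<in>set ps. r \<noteq> p \<and> (p, r) \<notin> hex_adj) \<and> induced_path (q # ps))"

lemma induced_path_Cons_iff:
  "ps \<noteq> [] \<Longrightarrow> induced_path (p # ps) \<longleftrightarrow>
     (p, hd ps) \<in> hex_adj \<and> (\<forall>r\<in>set (tl ps). r \<noteq> p \<and> (p, r) \<notin> hex_adj) \<and> induced_path ps"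
  by (cases ps) auto

lemma induced_path_distinct: "induced_path ps \<Longrightarrow> distinct ps"
  by (induction ps rule: induced_path.induct) (auto simp: hex_adj_irrefl)

lemma induced_path_append:
  assumes "induced_path xs" "induced_path ys" "xs \<noteq> []" "ys \<noteq> []" "(last xs, hd ys) \<in> hex_adj"
    and "\<And>x y. x \<in> set xs \<Longrightarrow> y \<in> set ys \<Longrightarrow> x \<noteq> y"
    and "\<And>x y. x \<in> set xs \<Longrightarrow> y \<in> set ys \<Longrightarrow> (x, y) \<in> hex_adj \<Longrightarrow> x = last xs \<and> y = hd ys"
  shows "induced_path (xs @ ys)"
  using assms
proof (induction xs rule: induced_path.induct)
  case (2 p)
  have "p \<notin> set ys" using "2.prems"(6)[of p p] by auto
  moreover have "r \<noteq> hd ys" if "r \<in> set (tl ys)" for r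
    using induced_path_distinct[OF 2(2)] that 2(4) by (cases ys) auto
  moreover have "(p, r) \<notin> hex_adj" if "r \<in> set (tl ys)" "r \<noteq> hd ys" for r
    using "2.prems"(7)[of p r] that list.set_sel(2)[OF "2.prems"(4) that(1)] by auto
  moreover have "r \<in> set ys" if "r \<in> set (tl ys)" for r
    using list.set_sel(2)[OF "2.prems"(4) that] .
  ultimately have "\<forall>r\<in>set (tl ys). r \<noteq> p \<and> (p, r) \<notin> hex_adj"
    using \<open>p \<notin> set ys\<close> by metis
  then show ?case
    using "2.prems"(2,4,5) by (simp add: induced_path_Cons_iff)
next
  case (3 p q ps)
  have neq: "p \<noteq> last (q # ps)"
    using induced_path_distinct[OF "3.prems"(1)] by (metis distinct.simps(2) last_in_set list.distinct(1))
  have "induced_path ((q # ps) @ ys)"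
  proof (rule "3.IH")
    show "induced_path (q # ps)" using "3.prems"(1) by simp
    show "(last (q # ps), hd ys) \<in> hex_adj" using "3.prems"(5) by simp
    show "x \<noteq> y" if "x \<in> set (q # ps)" "y \<in> set ys" for x y
      using "3.prems"(6)[of x y] that by simp
    show "x = last (q # ps) \<and> y = hd ys" if "x \<in> set (q # ps)" "y \<in> set ys" "(x, y) \<in> hex_adj" for x y
      using "3.prems"(7)[of x y] that by simp
  qed (use "3.prems"(2,4) in simp_all)
  moreover have "r \<noteq> p \<and> (p, r) \<notin> hex_adj" if "r \<in> set (ps @ ys)" for r
  proof (cases "r \<in> set ps")
    case True
    then show ?thesis using "3.prems"(1) by simp
  next
    case False
    with that have r: "r \<in> set ys" by simp
    then show ?thesis using "3.prems"(6)[of p r] "3.prems"(7)[of p r] neq by auto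
  qed
  ultimately show ?case using "3.prems"(1) by simp
qed simp

lemma induced_path_appendD:
  assumes "induced_path (xs @ ys)"
  shows "induced_path ys"
  using assms
proof (induction xs)
  case (Cons p xs)
  show ?case
  proof (cases "xs @ ys = []")
    case False
    then show ?thesis using Cons by (simp add: induced_path_Cons_iff)
  qed simp
qed simp

lemma induced_path_split:
  assumes "induced_path (xs @ r # ys)" "x \<in> set xs" "y \<in> set ys"
  shows "x \<noteq> y \<and> (x, y) \<notin> hex_adj"
  using assms
proof (induction xs)
  case (Cons p xs)
  have ne: "xs @ r # ys \<noteq> []" by simp
  have "y \<in> set (tl (xs @ r # ys))"
    using Cons.prems(3) by (cases xs) auto
  moreover have "induced_path (xs @ r # ys)" "\<forall>r\<in>set (tl (xs @ r # ys)). r \<noteq> p \<and> (p, r) \<notin> hex_adj"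
    using Cons.prems(1) by (simp_all add: induced_path_Cons_iff)
  ultimately show ?case using Cons by auto
qed simp

lemma induced_path_rev:
  assumes "induced_path ps"
  shows "induced_path (rev ps)"
  using assms
proof (induction ps rule: induced_path.induct)
  case (3 p q ps)
  have "induced_path (rev (q # ps) @ [p])"
    using 3 induced_path_distinct[OF "3.prems"] by (intro induced_path_append) (auto simp: hex_adj_sym last_rev dest: hex_adj_sym)
  then show ?case by simp
qed auto

lemma induced_path_map:
  assumes "induced_path ps" "\<And>p q. (f p, f q) \<in> hex_adj \<longleftrightarrow> (p, q) \<in> hex_adj" "inj f"
  shows "induced_path (map f ps)"
  using assms(1)
  by (induction ps rule: induced_path.induct) (auto simp: assms(2) inj_eq[OF assms(3)])

lemma induced_pathI:
  assumes "successively (\<lambda>p q. (p, q) \<in> hex_adj) ps"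
    and "\<And>i j. Suc i < j \<Longrightarrow> j < length ps \<Longrightarrow> ps ! i \<noteq> ps ! j \<and> (ps ! i, ps ! j) \<notin> hex_adj"
  shows "induced_path ps"
  using assms
proof (induction ps rule: induced_path.induct)
  case (3 p q ps)
  have "induced_path (q # ps)"
  proof (rule "3.IH")
    show "successively (\<lambda>p q. (p, q) \<in> hex_adj) (q # ps)" using "3.prems"(1) by simp
    fix i j assume "Suc i < j" "j < length (q # ps)"
    then show "(q # ps) ! i \<noteq> (q # ps) ! j \<and> ((q # ps) ! i, (q # ps) ! j) \<notin> hex_adj"
      using "3.prems"(2)[of "Suc i" "Suc j"] by simp
  qed
  moreover have "r \<noteq> p \<and> (p, r) \<notin> hex_adj" if r: "r \<in> set ps" for r
  proof -
    obtain k where "k < length ps" "ps ! k = r" using r unfolding in_set_conv_nth by blast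
    then show ?thesis using "3.prems"(2)[of 0 "Suc (Suc k)"] by auto
  qed
  ultimately show ?case using "3.prems"(1) by simp
qed auto

lemma induced_path_successively: "induced_path ps \<Longrightarrow> successively (\<lambda>p q. (p, q) \<in> hex_adj) ps"
  by (induction ps rule: induced_path.induct) auto

section \<open>Connectedness and winning paths in terms of lists of cells\<close>

lemma walk_reaches:
  assumes "successively (\<lambda>p q. (p, q) \<in> hex_adj) (p # ps)" "q \<in> set (p # ps)" "set (p # ps) \<subseteq> T"
  shows "(p, q) \<in> (Restr hex_adj T)\<^sup>*"
  using assms
proof (induction ps arbitrary: p)
  case (Cons r ps)
  show ?case
  proof (cases "q = p")
    case False
    then have "(r, q) \<in> (Restr hex_adj T)\<^sup>*" using Cons by auto
    moreover have "(p, r) \<in> Restr hex_adj T" using Cons.prems by auto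
    ultimately show ?thesis by (rule converse_rtrancl_into_rtrancl[rotated])
  qed simp
qed simp

lemma Restr_hex_adj_rtrancl_sym:
  "(p, q) \<in> (Restr hex_adj T)\<^sup>* \<Longrightarrow> (q, p) \<in> (Restr hex_adj T)\<^sup>*"
proof -
  have "sym (Restr hex_adj T)" by (auto simp: sym_def hex_adj_sym)
  then show "(p, q) \<in> (Restr hex_adj T)\<^sup>* \<Longrightarrow> (q, p) \<in> (Restr hex_adj T)\<^sup>*"
    using sym_rtrancl symD by metis
qed

lemma hex_connected_walk:
  assumes "successively (\<lambda>p q. (p, q) \<in> hex_adj) ps"
  shows "hex_connected (set ps)"
proof (cases ps)
  case (Cons p qs)
  have "(p, q) \<in> (Restr hex_adj (set ps))\<^sup>*" if "q \<in> set ps" for q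
    using walk_reaches[of p qs q "set ps"] assms that Cons by auto
  then show ?thesis
    unfolding hex_connected_def using Restr_hex_adj_rtrancl_sym by (meson rtrancl_trans)
qed (simp add: hex_connected_def)

lemma rtrancl_walk:
  assumes "(p, q) \<in> (Restr hex_adj T)\<^sup>*" "p \<in> T"
  obtains ps where "successively (\<lambda>p q. (p, q) \<in> hex_adj) ps" "ps \<noteq> []" "hd ps = p" "last ps = q" "set ps \<subseteq> T"
  using assms
proof (induction arbitrary: thesis rule: rtrancl_induct)
  case base
  show ?case by (rule base(1)[of "[p]"]) (use base in auto)
next
  case (step q r)
  obtain ps where ps: "successively (\<lambda>p q. (p, q) \<in> hex_adj) ps" "ps \<noteq> []" "hd ps = p" "last ps = q" "set ps \<subseteq> T"
    using step.IH step.prems by metis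
  show ?case
    by (rule step.prems(1)[of "ps @ [r]"]) (use ps step in \<open>auto simp: successively_append_iff\<close>)
qed

text \<open>These lists are exactly the winning paths, by \<open>winning_path_obtains_list\<close>
  and \<open>winning_path_of_list\<close>. The list form supplies the order and the ends that the
  counting uses.\<close>

definition crossing_path :: "nat \<Rightarrow> cell list \<Rightarrow> bool" where
  "crossing_path n ps \<longleftrightarrow> induced_path ps \<and> ps \<noteq> [] \<and> set ps \<subseteq> hex_board n \<and>
     snd (hd ps) = 1 \<and> snd (last ps) = int n \<and>
     (\<forall>p\<in>set ps. snd p = 1 \<longrightarrow> p = hd ps) \<and> (\<forall>p\<in>set ps. snd p = int n \<longrightarrow> p = last ps)"

text \<open>A shortest walk in S from row 1 to row n works: a repeated cell, a chord or a second
  visit to an end row would allow a shorter walk, and minimality of S leaves no cell of S outside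
  the walk.\<close>

lemma winning_path_obtains_list:
  assumes "winning_path n S"
  obtains ps where "crossing_path n ps" "set ps = S"
proof -
  let ?adj = "\<lambda>p q. (p, q) \<in> hex_adj"
  from assms have "winning_connection n S" by (simp add: winning_path_def)
  then obtain T where T0: "S \<subseteq> hex_board n" "T \<subseteq> S" "hex_connected T"
    "T \<inter> hex_row n 1 \<noteq> {}" "T \<inter> hex_row n n \<noteq> {}"
    unfolding winning_connection_def by - (elim conjE exE, rule that)
  from T0(4) obtain p where p: "p \<in> T" "p \<in> hex_row n 1" by blast
  from T0(5) obtain q where q: "q \<in> T" "q \<in> hex_row n n" by blast
  note T = T0(1-3) p q
  define W where "W = (\<lambda>ws. successively ?adj ws \<and> ws \<noteq> [] \<and> set ws \<subseteq> S \<and> snd (hd ws) = 1 \<and> snd (last ws) = int n)"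
  have "(p, q) \<in> (Restr hex_adj T)\<^sup>*" using T(3,4,6) unfolding hex_connected_def by blast
  from rtrancl_walk[OF this T(4)] obtain ps0 where ps0: "successively ?adj ps0" "ps0 \<noteq> []" "hd ps0 = p" "last ps0 = q" "set ps0 \<subseteq> T"
    by metis
  have "W ps0" using ps0 T by (auto simp: W_def hex_row_def)
  define ws where "ws = arg_min length W"
  have Wws: "W ws" and least: "\<And>vs. W vs \<Longrightarrow> length ws \<le> length vs"
    using arg_min_nat_lemma[of W ps0 length] \<open>W ps0\<close> unfolding ws_def by auto
  have succ: "successively ?adj ws" and ne: "ws \<noteq> []" and sub: "set ws \<subseteq> S"
    and hd1: "snd (hd ws) = 1" and lastn: "snd (last ws) = int n"
    using Wws by (auto simp: W_def)
  have splice: False if ij: "Suc i < j" "j < length ws" and c: "ws ! i = ws ! j \<or> ?adj (ws ! i) (ws ! j)" for i j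
  proof -
    \<comment> \<open>If the two cells coincide, the first occurrence is cut out as well; if they
      are adjacent, it stays and is followed directly by \<open>ws ! j\<close>. Either way
      \<open>k < j\<close>, so the walk gets shorter.\<close>
    define k where "k = (if ws ! i = ws ! j then i else Suc i)"
    let ?vs = "take k ws @ drop j ws"
    have sd: "successively ?adj (take k ws)" "successively ?adj (drop j ws)"
      using succ by (metis append_take_drop_id successively_append_iff)+
    have hdd: "hd (drop j ws) = ws ! j" using ij by (simp add: hd_drop_conv_nth)
    have k: "k \<le> Suc i" "k < j" using ij by (auto simp: k_def)
    have adj: "?adj (last (take k ws)) (hd (drop j ws))" if "k \<noteq> 0"
    proof (cases "ws ! i = ws ! j")
      case True
      then have "k = i" "i > 0" using that by (auto simp: k_def)
      have "?adj (ws ! (i - 1)) (ws ! i)"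
        using succ[unfolded successively_conv_nth, rule_format, of "i - 1"] ij \<open>i > 0\<close> by simp
      moreover have "last (take i ws) = ws ! (i - 1)" using ij \<open>i > 0\<close> ne by (subst last_conv_nth) (auto simp: min_def)
      ultimately show ?thesis using True \<open>k = i\<close> hdd by simp
    next
      case False
      then show ?thesis using c hdd ij ne by (subst last_conv_nth) (auto simp: k_def min_def)
    qed
    have "W ?vs"
      unfolding W_def
    proof (intro conjI)
      show "successively ?adj ?vs" using sd adj ij by (auto simp: successively_append_iff)
      show "?vs \<noteq> []" using ij by simp
      show "set ?vs \<subseteq> S" using sub set_take_subset[of k ws] set_drop_subset[of j ws] by auto
      show "snd (last ?vs) = int n" using lastn ij by (simp add: last_drop)
      \<comment> \<open>If nothing is kept in front, the new head \<open>ws ! j\<close> repeats the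
        old one.\<close>
      show "snd (hd ?vs) = 1"
      proof (cases "k = 0")
        case True
        then have "i = 0" "ws ! i = ws ! j" by (auto simp: k_def split: if_splits)
        then show ?thesis using hd1 True hdd ne by (simp add: hd_conv_nth)
      qed (use hd1 ne in simp)
    qed
    from least[OF this] show False using ij k by (simp add: min_def)
  qed
  have "induced_path ws"
    using induced_pathI[OF succ] splice by blast
  moreover have "p = hd ws" if "p \<in> set ws" "snd p = 1" for p
  proof (rule ccontr)
    assume "p \<noteq> hd ws"
    obtain i where i: "i < length ws" "ws ! i = p" using \<open>p \<in> set ws\<close> by (metis in_set_conv_nth)
    then have "i \<noteq> 0" using \<open>p \<noteq> hd ws\<close> ne by (metis hd_conv_nth)
    have "W (drop i ws)" unfolding W_def
    proof (intro conjI)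
      show "successively ?adj (drop i ws)" using succ by (metis append_take_drop_id successively_append_iff)
      show "set (drop i ws) \<subseteq> S" using set_drop_subset sub by (rule order_trans)
      show "snd (hd (drop i ws)) = 1" using i that by (simp add: hd_drop_conv_nth)
    qed (use i lastn in \<open>simp_all add: last_drop\<close>)
    from least[OF this] show False using i \<open>i \<noteq> 0\<close> by simp
  qed
  moreover have "p = last ws" if "p \<in> set ws" "snd p = int n" for p
  proof (rule ccontr)
    assume "p \<noteq> last ws"
    obtain i where i: "i < length ws" "ws ! i = p" using \<open>p \<in> set ws\<close> by (metis in_set_conv_nth)
    then have "Suc i \<noteq> length ws" using \<open>p \<noteq> last ws\<close> ne by (metis diff_Suc_1 last_conv_nth)
    have "W (take (Suc i) ws)" unfolding W_def
    proof (intro conjI)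
      show "successively ?adj (take (Suc i) ws)" using succ by (metis append_take_drop_id successively_append_iff)
      show "set (take (Suc i) ws) \<subseteq> S" using set_take_subset sub by (rule order_trans)
      show "snd (last (take (Suc i) ws)) = int n" using i that by (simp add: take_Suc_conv_app_nth)
    qed (use ne hd1 in simp_all)
    from least[OF this] show False using i \<open>Suc i \<noteq> length ws\<close> by simp
  qed
  moreover have "set ws = S"
  proof (rule ccontr)
    assume "set ws \<noteq> S"
    then have "set ws \<subset> S" using sub by auto
    moreover have "winning_connection n (set ws)"
      unfolding winning_connection_def
    proof (intro conjI exI[of _ "set ws"])
      have "hd ws \<in> hex_row n 1" "last ws \<in> hex_row n n"
        using hd_in_set[OF ne] last_in_set[OF ne] hd1 lastn subsetD[OF sub] subsetD[OF T(1)]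
        by (simp_all add: mem_hex_row_iff)
      then show "set ws \<inter> hex_row n 1 \<noteq> {}" "set ws \<inter> hex_row n n \<noteq> {}"
        using hd_in_set[OF ne] last_in_set[OF ne] by blast+
    qed (use sub T hex_connected_walk[OF succ] in auto)
    ultimately show False using assms by (auto simp: winning_path_def)
  qed
  ultimately show thesis
    using that[of ws] ne hd1 lastn T(1) by (auto simp: crossing_path_def)
qed

text \<open>Removing an inner cell of an induced path separates its two ends. A connected subset
  that meets both end rows contains both ends, hence every cell.\<close>

lemma winning_path_of_list:
  assumes "crossing_path n ps"
  shows "winning_path n (set ps)"
  unfolding winning_path_def
proof (intro conjI allI impI)
  have ip: "induced_path ps" and ne: "ps \<noteq> []" and sub: "set ps \<subseteq> hex_board n"
    and hd1: "snd (hd ps) = 1" and lastn: "snd (last ps) = int n"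
    and only1: "\<And>p. p \<in> set ps \<Longrightarrow> snd p = 1 \<Longrightarrow> p = hd ps"
    and onlyn: "\<And>p. p \<in> set ps \<Longrightarrow> snd p = int n \<Longrightarrow> p = last ps"
    using assms by (auto simp: crossing_path_def)
  show "winning_connection n (set ps)"
    unfolding winning_connection_def
  proof (intro conjI exI[of _ "set ps"])
    show "set ps \<inter> hex_row n 1 \<noteq> {}" "set ps \<inter> hex_row n n \<noteq> {}"
      using hd_in_set[OF ne] last_in_set[OF ne] hd1 lastn sub by (fastforce simp: hex_row_def)+
  qed (use sub hex_connected_walk[OF induced_path_successively[OF ip]] in auto)
  fix S' assume "S' \<subset> set ps"
  show "\<not> winning_connection n S'"
  proof
    assume "winning_connection n S'"
    then obtain T where T0: "T \<subseteq> S'" "hex_connected T"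
      "T \<inter> hex_row n 1 \<noteq> {}" "T \<inter> hex_row n n \<noteq> {}"
      unfolding winning_connection_def by - (elim conjE exE, rule that)
    from T0(3) obtain p where p: "p \<in> T" "p \<in> hex_row n 1" by blast
    from T0(4) obtain q where q: "q \<in> T" "q \<in> hex_row n n" by blast
    have "snd p = 1" "snd q = int n" using p(2) q(2) by (auto simp: hex_row_def)
    note T = T0(1,2) p(1) this(1) q(1) this(2)
    have "p = hd ps" "q = last ps" using only1 onlyn T \<open>S' \<subset> set ps\<close> by blast+
    obtain r where "r \<in> set ps" "r \<notin> T" using T(1) \<open>S' \<subset> set ps\<close> by blast
    then obtain us vs where ps: "ps = us @ r # vs" by (auto dest: split_list)
    have "us \<noteq> []" "vs \<noteq> []" using \<open>p = hd ps\<close> \<open>q = last ps\<close> T \<open>r \<notin> T\<close> ps by auto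
    have "p \<in> set us" "q \<in> set vs" using \<open>p = hd ps\<close> \<open>q = last ps\<close> ps \<open>us \<noteq> []\<close> \<open>vs \<noteq> []\<close> by auto
    have "(p, q) \<in> (Restr hex_adj T)\<^sup>*" using T(2,3,5) unfolding hex_connected_def by blast
    \<comment> \<open>Invariant: a walk inside T that starts before the missing cell r never gets
      past it, as no cell of \<open>us\<close> is adjacent to one of \<open>vs\<close>.\<close>
    then have "q \<in> set us"
    proof (induction rule: rtrancl_induct)
      case (step x y)
      have "y \<in> set ps" using step T(1) \<open>S' \<subset> set ps\<close> by blast
      moreover have "y \<noteq> r" using step \<open>r \<notin> T\<close> by blast
      moreover have "y \<notin> set vs" using induced_path_split[of us r vs x y] ip ps step by auto
      ultimately show ?case using ps by auto
    qed fact
    then show False using \<open>q \<in> set vs\<close> induced_path_distinct[OF ip] ps by auto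
  qed
qed

section \<open>Counting triangles\<close>

lemma induced_path_adj_hd:
  assumes "induced_path (p # ps)" "q \<in> set ps" "(p, q) \<in> hex_adj"
  shows "q = hd ps"
  using assms by (cases ps) auto

text \<open>Inclusion-exclusion stops at consecutive cells: only adjacent cells may have
  intersecting images, and among the later cells the head is adjacent to its successor alone. This
  is applied to the triangles of either half and to a covering of the antidiagonal.\<close>

lemma card_UN_induced_path:
  fixes F :: "cell \<Rightarrow> 'b set"
  assumes ip: "induced_path ps" and fin: "\<And>p. finite (F p)"
    and disj: "\<And>p q. p \<noteq> q \<Longrightarrow> (p, q) \<notin> hex_adj \<Longrightarrow> F p \<inter> F q = {}"
  shows "int (card (\<Union>p\<in>set ps. F p)) =
    (\<Sum>p\<leftarrow>ps. int (card (F p))) - (\<Sum>(p, q)\<leftarrow>zip ps (tl ps). int (card (F p \<inter> F q)))"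
  using ip
proof (induction ps rule: induced_path.induct)
  case (3 p q ps)
  let ?U = "\<Union>r\<in>set (q # ps). F r"
  have dis: "p \<notin> set (q # ps)" using induced_path_distinct[OF "3.prems"] by simp
  have "F p \<inter> F r = {}" if "r \<in> set ps" for r
    using "3.prems" that by (intro disj) auto
  then have I: "F p \<inter> ?U = F p \<inter> F q" by auto
  have "card (F p) + card ?U = card (F p \<union> ?U) + card (F p \<inter> ?U)"
    by (rule card_Un_Int) (simp_all add: fin)
  then have "int (card (\<Union>r\<in>set (p # q # ps). F r)) = int (card (F p)) + int (card ?U) - int (card (F p \<inter> F q))"
    unfolding I by simp
  then show ?case using 3 by simp
qed simp_all

text \<open>The triangle \<open>(x, y)\<close> has the cells \<open>(x, y)\<close>, \<open>(x - 1, y + 1)\<close> and \<open>(x, y + 1)\<close>. For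
  \<open>x = 1\<close> one of them lies in the column \<open>0\<close> outside the board, so that such a triangle is empty
  when two consecutive cells of column \<open>1\<close> are.\<close>
definition tri_index :: "nat \<Rightarrow> cell set" where
  "tri_index n = {(x, y). 1 \<le> x \<and> 1 \<le> y \<and> x + y \<le> int n}"

definition tri_cells :: "cell \<Rightarrow> cell set" where
  "tri_cells t = {t, (fst t - 1, snd t + 1), (fst t, snd t + 1)}"

definition tris :: "nat \<Rightarrow> cell \<Rightarrow> cell set" where
  "tris n p = {p, (fst p + 1, snd p - 1), (fst p, snd p - 1)} \<inter> tri_index n"

definition empty_tris :: "nat \<Rightarrow> cell set \<Rightarrow> cell set" where
  "empty_tris n S = {t \<in> tri_index n. tri_cells t \<inter> S = {}}"

definition rotate_board :: "nat \<Rightarrow> cell \<Rightarrow> cell" where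
  "rotate_board n p = (int n + 1 - fst p, int n + 1 - snd p)"

lemma finite_tri_index [simp]: "finite (tri_index n)"
proof -
  have "tri_index n \<subseteq> {1..int n} \<times> {1..int n}" by (auto simp: tri_index_def)
  then show ?thesis by (rule finite_subset) simp
qed

lemma card_tri_index: "2 * int (card (tri_index n)) = int n * (int n - 1)"
proof (induction n)
  case 0
  have "tri_index 0 = {}" by (auto simp: tri_index_def)
  then show ?case by simp
next
  case (Suc n)
  let ?f = "\<lambda>x. (x, int n + 1 - x)"
  have "tri_index (Suc n) = tri_index n \<union> ?f ` {1..int n}"
    by (auto simp: tri_index_def image_iff)
  moreover have "tri_index n \<inter> ?f ` {1..int n} = {}"
    by (auto simp: tri_index_def)
  moreover have "card (?f ` {1..int n}) = n"
    by (subst card_image) (auto simp: inj_on_def)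
  ultimately have "card (tri_index (Suc n)) = card (tri_index n) + n"
    by (simp add: card_Un_disjoint)
  then show ?case using Suc by (simp add: algebra_simps)
qed

lemma finite_tris [simp]: "finite (tris n p)"
  by (simp add: tris_def)

lemma mem_tris_iff: "t \<in> tris n p \<longleftrightarrow> t \<in> tri_index n \<and> p \<in> tri_cells t"
  by (cases t; cases p) (auto simp: tris_def tri_cells_def)

lemma card_empty_tris: "int (card (empty_tris n S)) = int (card (tri_index n)) - int (card (\<Union>p\<in>S. tris n p))"
proof -
  have "(\<Union>p\<in>S. tris n p) \<subseteq> tri_index n" by (auto simp: tris_def)
  moreover have "empty_tris n S = tri_index n - (\<Union>p\<in>S. tris n p)"
    by (auto simp: empty_tris_def mem_tris_iff)
  ultimately show ?thesis
    by (simp add: card_Diff_subset finite_subset[OF _ finite_tri_index] of_nat_diff card_mono)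
qed

lemma tri_cells_adj: "p \<in> tri_cells t \<Longrightarrow> q \<in> tri_cells t \<Longrightarrow> p \<noteq> q \<Longrightarrow> (p, q) \<in> hex_adj"
  by (simp only: tri_cells_def insert_iff empty_iff, elim disjE; cases t; simp add: hex_adj_def)

lemma tris_disjoint: "p \<noteq> q \<Longrightarrow> (p, q) \<notin> hex_adj \<Longrightarrow> tris n p \<inter> tris n q = {}"
  unfolding set_eq_iff Int_iff mem_tris_iff using tri_cells_adj[of p _ q] by blast

lemma card_tris:
  "int (card (tris n (a, b))) =
    of_bool ((a, b) \<in> tri_index n) + of_bool ((a + 1, b - 1) \<in> tri_index n) + of_bool ((a, b - 1) \<in> tri_index n)"
  by (simp add: tris_def Int_insert_left card_insert_if)

text \<open>Each edge of the lattice lies in one triangle of either orientation; for the orientation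
  of \<open>tri_cells\<close> that triangle has this index.\<close>

lemma tris_Int_adj:
  assumes "((a, b), (c, d)) \<in> hex_adj"
  shows "tris n (a, b) \<inter> tris n (c, d) = {(max a c, max b d - 1)} \<inter> tri_index n"
  using assms by (auto simp: tris_def hex_adj_iff)

lemma hex_adj_rotate [simp]:
  "(rotate_board n p, rotate_board n q) \<in> hex_adj \<longleftrightarrow> (p, q) \<in> hex_adj"
proof -
  have reflect: "(m - u) - (m - v) = v - u" for m u v :: int by simp
  have "(rotate_board n p, rotate_board n q) \<in> hex_adj \<longleftrightarrow> (q, p) \<in> hex_adj"
    by (cases p; cases q)
      (simp only: rotate_board_def fst_conv snd_conv hex_adj_def mem_Collect_eq prod.case reflect)
  then show ?thesis using hex_adj_sym by blast
qed

lemma rotate_rotate [simp]: "rotate_board n (rotate_board n p) = p"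
  by (simp add: rotate_board_def)

lemma inj_rotate: "inj (rotate_board n)"
  by (rule inj_on_inverseI[of _ "rotate_board n"]) simp

lemma rotate_mem_board_iff: "rotate_board n p \<in> hex_board n \<longleftrightarrow> p \<in> hex_board n"
  by (cases p) (auto simp: rotate_board_def hex_board_def)

lemma crossing_path_rotate:
  assumes "crossing_path n ps"
  shows "crossing_path n (rev (map (rotate_board n) ps))"
proof -
  have "induced_path (rev (map (rotate_board n) ps))"
    using assms by (intro induced_path_rev induced_path_map) (auto simp: crossing_path_def inj_rotate)
  moreover have "set (rev (map (rotate_board n) ps)) \<subseteq> hex_board n"
    using assms by (auto simp: crossing_path_def rotate_mem_board_iff)
  ultimately show ?thesis
    using assms by (auto simp: crossing_path_def hd_rev last_rev hd_map last_map rotate_board_def)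
qed

section \<open>Weights of cells and edges, and runs on the antidiagonal\<close>

definition on_diag :: "nat \<Rightarrow> cell \<Rightarrow> bool" where
  "on_diag n p \<longleftrightarrow> fst p + snd p = int n + 1"

text \<open>Antidiagonal cells are addressed by their column, so that runs of the path become runs
  of a boolean sequence.\<close>

definition diag_cell :: "nat \<Rightarrow> cell set \<Rightarrow> nat \<Rightarrow> bool" where
  "diag_cell n S q \<longleftrightarrow> (int q, int n + 1 - int q) \<in> S"

text \<open>Off the antidiagonal a cell lies in three triangles of its own half, on it in one of
  each half. A cell in row 1 or n loses two of them, but a corner on the antidiagonal only one,
  hence the last summand.\<close>

lemma weight_cell:
  assumes "p \<in> hex_board n" "n \<ge> 2"
  shows "int (card (tris n p)) + int (card (tris n (rotate_board n p))) =
    3 - of_bool (on_diag n p) - 2 * of_bool (snd p = 1 \<or> snd p = int n) + of_bool (on_diag n p \<and> (snd p = 1 \<or> snd p = int n))"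
proof (cases p)
  case (Pair a b)
  then show ?thesis using assms
    by (auto simp: rotate_board_def card_tris tri_index_def on_diag_def hex_board_def of_bool_def)
qed

text \<open>An edge lies in one triangle of exactly one half, but an edge along the antidiagonal
  lies in none of the counted triangles. An edge inside row 1 or row n would lose its triangle; a
  crossing path has no such edge.\<close>

lemma weight_edge:
  assumes "p \<in> hex_board n" "q \<in> hex_board n" "n \<ge> 2" "(p, q) \<in> hex_adj"
    and "\<not> (snd p = 1 \<and> snd q = 1)" "\<not> (snd p = int n \<and> snd q = int n)"
  shows "int (card (tris n p \<inter> tris n q)) + int (card (tris n (rotate_board n p) \<inter> tris n (rotate_board n q))) =
    1 - of_bool (on_diag n p \<and> on_diag n q)"
proof -
  obtain a b where p: "p = (a, b)" by (cases p)
  obtain c d where q: "q = (c, d)" by (cases q)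
  have r: "((int n + 1 - a, int n + 1 - b), (int n + 1 - c, int n + 1 - d)) \<in> hex_adj"
    using assms(4) hex_adj_rotate[of n p q] by (simp add: p q rotate_board_def)
  have 1: "int (card (tris n p \<inter> tris n q)) =
      of_bool (1 \<le> max a c \<and> 1 \<le> max b d - 1 \<and> max a c + (max b d - 1) \<le> int n)"
    unfolding p q tris_Int_adj[OF assms(4)[unfolded p q]] by (simp add: Int_insert_left tri_index_def)
  have 2: "int (card (tris n (rotate_board n p) \<inter> tris n (rotate_board n q))) =
      of_bool (1 \<le> max (int n + 1 - a) (int n + 1 - c) \<and> 1 \<le> max (int n + 1 - b) (int n + 1 - d) - 1 \<and>
        max (int n + 1 - a) (int n + 1 - c) + (max (int n + 1 - b) (int n + 1 - d) - 1) \<le> int n)"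
    unfolding p q rotate_board_def fst_conv snd_conv tris_Int_adj[OF r] by (simp add: Int_insert_left tri_index_def)
  have bds: "1 \<le> a" "a \<le> int n" "1 \<le> b" "b \<le> int n" "1 \<le> c" "c \<le> int n" "1 \<le> d" "d \<le> int n"
    using assms(1,2) by (auto simp: p q hex_board_def)
  have "\<not> (b = 1 \<and> d = 1)" "\<not> (b = int n \<and> d = int n)" using assms(5,6) by (auto simp: p q)
  then show ?thesis
    using bds assms(4) unfolding 1 2 unfolding p q on_diag_def fst_conv snd_conv hex_adj_iff
    by (elim disjE conjE; auto simp: max_def of_bool_def)
qed

lemma sum_list_zip_cong:
  assumes "induced_path ps" "\<And>p q. p \<in> set ps \<Longrightarrow> q \<in> set ps \<Longrightarrow> (p, q) \<in> hex_adj \<Longrightarrow> f p q = g p q"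
  shows "(\<Sum>(p, q)\<leftarrow>zip ps (tl ps). f p q) = (\<Sum>(p, q)\<leftarrow>zip ps (tl ps). g p q)"
  using assms by (induction ps rule: induced_path.induct) auto

text \<open>The antidiagonal cells minus the antidiagonal steps of the path count its runs on the
  antidiagonal, and each run begins with one transition. The sum includes \<open>q = 0\<close>, where
  \<^const>\<open>diag_cell\<close> is false.\<close>
lemma diag_runs:
  assumes ip: "induced_path ps" and sub: "set ps \<subseteq> hex_board n"
  shows "(\<Sum>p\<leftarrow>ps. of_bool (on_diag n p)) - (\<Sum>(p, q)\<leftarrow>zip ps (tl ps). of_bool (on_diag n p \<and> on_diag n q))
    = (\<Sum>q<n. of_bool (\<not> diag_cell n (set ps) q \<and> diag_cell n (set ps) (Suc q)) :: int)"
proof -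
  let ?d = "diag_cell n (set ps)"
  \<comment> \<open>\<open>F\<close> sends the cell in column a to {a - 1, a}, so a cell counts 2
    and an antidiagonal step has overlap 1. The union consists of the occupied columns and the
    columns just before a run; comparing the two counts gives the number of runs. \<open>F'\<close>
    is empty outside the board, where \<open>nat\<close> and truncated subtraction would destroy
    disjointness.\<close>
  define F where "F = (\<lambda>p. if on_diag n p then {nat (fst p) - 1, nat (fst p)} else {})"
  define F' where "F' = (\<lambda>p. if p \<in> hex_board n then F p else {})"
  have disj: "F' p \<inter> F' q = {}" if "p \<noteq> q" "(p, q) \<notin> hex_adj" for p q
  proof (cases "p \<in> hex_board n \<and> q \<in> hex_board n \<and> on_diag n p \<and> on_diag n q")
    case True
    obtain a b c d where pq: "p = (a, b)" "q = (c, d)" by (cases p; cases q)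
    have bd: "b = int n + 1 - a" "d = int n + 1 - c" "1 \<le> a" "1 \<le> c"
      using True by (auto simp: pq on_diag_def hex_board_def)
    then have "a \<noteq> c \<and> a \<noteq> c + 1 \<and> c \<noteq> a + 1"
      using \<open>p \<noteq> q\<close> \<open>(p, q) \<notin> hex_adj\<close> by (auto simp: pq hex_adj_iff)
    then have "{nat a - 1, nat a} \<inter> {nat c - 1, nat c} = {}" using bd by auto
    then show ?thesis using True by (simp add: F'_def F_def pq)
  qed (auto simp: F'_def F_def)
  have c1: "int (card (F' p)) = 2 * of_bool (on_diag n p)" if "p \<in> hex_board n" for p
    using that by (cases p) (auto simp: F'_def F_def hex_board_def)
  have c2: "int (card (F' p \<inter> F' q)) = of_bool (on_diag n p \<and> on_diag n q)"
    if "p \<in> hex_board n" "q \<in> hex_board n" "(p, q) \<in> hex_adj" for p q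
  proof -
    obtain a b c d where [simp]: "p = (a, b)" "q = (c, d)" by (cases p; cases q)
    have "F' p \<inter> F' q = (if on_diag n p \<and> on_diag n q then {nat (min a c)} else {})"
      using that by (auto simp: F'_def F_def hex_board_def on_diag_def hex_adj_iff min_def)
    then show ?thesis by simp
  qed
  have s1: "(\<Sum>p\<leftarrow>ps. int (card (F' p))) = 2 * (\<Sum>p\<leftarrow>ps. of_bool (on_diag n p))"
    using sub by (induction ps) (auto simp: c1)
  have s2: "(\<Sum>(p, q)\<leftarrow>zip ps (tl ps). int (card (F' p \<inter> F' q))) =
      (\<Sum>(p, q)\<leftarrow>zip ps (tl ps). of_bool (on_diag n p \<and> on_diag n q))"
    using sub by (intro sum_list_zip_cong[OF ip] c2) auto
  have U: "(\<Union>p\<in>set ps. F' p) = {q. q \<le> n \<and> (?d q \<or> ?d (Suc q))}"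
  proof (intro set_eqI iffI)
    fix q assume "q \<in> (\<Union>p\<in>set ps. F' p)"
    then obtain a b where ab: "(a, b) \<in> set ps" "q \<in> F' (a, b)" by auto
    then have "b = int n + 1 - a" "1 \<le> a" "a \<le> int n" "q = nat a - 1 \<or> q = nat a"
      by (auto simp: F'_def F_def on_diag_def hex_board_def split: if_splits)
    moreover define m where "m = nat (a - 1)"
    ultimately have m: "a = int (Suc m)" "b = int n + 1 - int (Suc m)" "m < n" "q = m \<or> q = Suc m"
      by auto
    then have "?d (Suc m)" using ab(1) by (simp add: diag_cell_def)
    then show "q \<in> {q. q \<le> n \<and> (?d q \<or> ?d (Suc q))}"
      using m(3,4) by auto
  next
    fix q assume "q \<in> {q. q \<le> n \<and> (?d q \<or> ?d (Suc q))}"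
    then obtain r where r: "?d r" "q = r \<or> Suc q = r" by auto
    then have mem: "(int r, int n + 1 - int r) \<in> set ps" by (simp add: diag_cell_def)
    moreover have "q \<in> F' (int r, int n + 1 - int r)"
      using subsetD[OF sub mem] r(2) by (auto simp: F'_def F_def on_diag_def)
    ultimately show "q \<in> (\<Union>p\<in>set ps. F' p)" by blast
  qed
  have d0: "\<not> ?d 0" "\<not> ?d (Suc n)" using sub by (auto simp: diag_cell_def hex_board_def)
  have KD: "(\<Sum>p\<leftarrow>ps. of_bool (on_diag n p)) = int (card {q. q \<le> n \<and> ?d q})"
  proof -
    have "(\<Sum>p\<leftarrow>ps. of_bool (on_diag n p)) = (\<Sum>p\<in>set ps. of_bool (on_diag n p) :: int)"
      using induced_path_distinct[OF ip] by (simp add: sum_list_distinct_conv_sum_set)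
    also have "\<dots> = int (card {p \<in> set ps. on_diag n p})"
      by (simp add: of_bool_def sum.If_cases Collect_conj_eq Int_commute)
    also have "{p \<in> set ps. on_diag n p} = (\<lambda>q. (int q, int n + 1 - int q)) ` {q. q \<le> n \<and> ?d q}"
    proof (intro set_eqI iffI)
      fix p assume "p \<in> {p \<in> set ps. on_diag n p}"
      moreover obtain a b where ab: "p = (a, b)" by (cases p)
      ultimately have p: "(a, b) \<in> set ps" "b = int n + 1 - a" by (auto simp: on_diag_def)
      then have "1 \<le> a" "a \<le> int n" using sub by (auto simp: hex_board_def)
      then show "p \<in> (\<lambda>q. (int q, int n + 1 - int q)) ` {q. q \<le> n \<and> ?d q}"
        using ab p by (intro image_eqI[of _ _ "nat a"]) (auto simp: diag_cell_def)
    qed (auto simp: diag_cell_def on_diag_def)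
    also have "card \<dots> = card {q. q \<le> n \<and> ?d q}"
      by (rule card_image) (auto simp: inj_on_def)
    finally show ?thesis by simp
  qed
  have eq: "{q. q \<le> n \<and> (?d q \<or> ?d (Suc q))} = {q. q \<le> n \<and> ?d q} \<union> {q \<in> {..<n}. \<not> ?d q \<and> ?d (Suc q)}"
  proof (intro set_eqI iffI)
    fix q assume "q \<in> {q. q \<le> n \<and> (?d q \<or> ?d (Suc q))}"
    then show "q \<in> {q. q \<le> n \<and> ?d q} \<union> {q \<in> {..<n}. \<not> ?d q \<and> ?d (Suc q)}"
      using d0 by (cases "q = n") auto
  qed auto
  have "card {q. q \<le> n \<and> (?d q \<or> ?d (Suc q))} =
      card {q. q \<le> n \<and> ?d q} + card {q \<in> {..<n}. \<not> ?d q \<and> ?d (Suc q)}"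
    unfolding eq by (rule card_Un_disjoint) auto
  moreover have "int (card {q \<in> {..<n}. \<not> ?d q \<and> ?d (Suc q)}) = (\<Sum>q<n. of_bool (\<not> ?d q \<and> ?d (Suc q)))"
    by (simp add: of_bool_def sum.If_cases Collect_conj_eq Int_commute lessThan_def)
  moreover have "int (card (\<Union>p\<in>set ps. F' p)) = 2 * (\<Sum>p\<leftarrow>ps. of_bool (on_diag n p)) -
      (\<Sum>(p, q)\<leftarrow>zip ps (tl ps). of_bool (on_diag n p \<and> on_diag n q))"
    unfolding s1[symmetric] s2[symmetric]
    by (rule card_UN_induced_path[OF ip _ disj]) (simp_all add: F'_def F_def)
  ultimately show ?thesis using KD U by simp
qed

lemma mem_rotate_image_iff: "p \<in> rotate_board n ` S \<longleftrightarrow> rotate_board n p \<in> S"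
  by (metis imageE imageI rotate_rotate)

text \<open>Both halves are counted by \<open>card_UN_induced_path\<close> and added. A run that
  begins in column 1 cancels against the corner correction of \<open>weight_cell\<close> at (1, n),
  so the sum starts with the transition from column 1 to column 2; the correction at (n, 1) remains
  as the term with \<open>d n\<close>.\<close>

lemma crossing_path_count:
  assumes cp: "crossing_path n ps" and n: "n \<ge> 2"
  defines "d \<equiv> diag_cell n (set ps)"
  shows "2 * int (length ps) = int n * int n - int n + 3 + (\<Sum>q=1..<n. of_bool (\<not> d q \<and> d (Suc q))) - of_bool (d n)
    - int (card (empty_tris n (set ps))) - int (card (empty_tris n (rotate_board n ` set ps)))"
proof -
  have ip: "induced_path ps" and ne: "ps \<noteq> []" and sub: "set ps \<subseteq> hex_board n"
    and hd1: "snd (hd ps) = 1" and lastn: "snd (last ps) = int n"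
    and only1: "\<And>p. p \<in> set ps \<Longrightarrow> snd p = 1 \<Longrightarrow> p = hd ps"
    and onlyn: "\<And>p. p \<in> set ps \<Longrightarrow> snd p = int n \<Longrightarrow> p = last ps"
    using cp by (auto simp: crossing_path_def)
  note dist = induced_path_distinct[OF ip]
  let ?T = "\<lambda>p. tris n (rotate_board n p)"
  let ?row = "\<lambda>p. snd p = 1 \<or> snd p = int n"
  have c1: "int (card (\<Union>p\<in>set ps. tris n p)) =
    (\<Sum>p\<leftarrow>ps. int (card (tris n p))) - (\<Sum>(p, q)\<leftarrow>zip ps (tl ps). int (card (tris n p \<inter> tris n q)))"
    by (rule card_UN_induced_path[OF ip _ tris_disjoint]) simp_all
  have c2: "int (card (\<Union>p\<in>set ps. ?T p)) =
    (\<Sum>p\<leftarrow>ps. int (card (?T p))) - (\<Sum>(p, q)\<leftarrow>zip ps (tl ps). int (card (?T p \<inter> ?T q)))"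
  proof (rule card_UN_induced_path[OF ip])
    show "?T p \<inter> ?T q = {}" if "p \<noteq> q" "(p, q) \<notin> hex_adj" for p q
      using that by (intro tris_disjoint) (simp_all add: inj_eq[OF inj_rotate])
  qed simp
  have "(\<Sum>p\<leftarrow>ps. int (card (tris n p))) + (\<Sum>p\<leftarrow>ps. int (card (?T p))) =
    (\<Sum>p\<leftarrow>ps. int (card (tris n p)) + int (card (?T p)))"
    by (simp add: sum_list_addf)
  also have "\<dots> = (\<Sum>p\<leftarrow>ps. 3 - of_bool (on_diag n p) - 2 * of_bool (?row p) + of_bool (on_diag n p \<and> ?row p))"
    using sub weight_cell[OF _ n] by (intro arg_cong[of _ _ sum_list] map_cong) auto
  also have "\<dots> = 3 * int (length ps) - (\<Sum>p\<leftarrow>ps. of_bool (on_diag n p)) - 2 * (\<Sum>p\<leftarrow>ps. of_bool (?row p))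
      + (\<Sum>p\<leftarrow>ps. of_bool (on_diag n p \<and> ?row p))"
    by (simp add: sum_list_addf sum_list_subtractf sum_list_const_mult sum_list_triv)
  also have "(\<Sum>p\<leftarrow>ps. of_bool (?row p)) = (2 :: int)"
  proof -
    have "hd ps \<noteq> last ps" using hd1 lastn n by auto
    have "(\<Sum>p\<leftarrow>ps. of_bool (?row p)) = (\<Sum>p\<in>set ps. of_bool (?row p) :: int)"
      using dist by (simp add: sum_list_distinct_conv_sum_set)
    also have "\<dots> = (\<Sum>p\<in>{hd ps, last ps}. 1)"
      using only1 onlyn ne hd1 lastn by (intro sum.mono_neutral_cong_right) auto
    also have "\<dots> = 2" using \<open>hd ps \<noteq> last ps\<close> by simp
    finally show ?thesis .
  qed
  also have "(\<Sum>p\<leftarrow>ps. of_bool (on_diag n p \<and> ?row p)) = (of_bool (d 1) + of_bool (d n) :: int)"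
  proof -
    have "(\<Sum>p\<leftarrow>ps. of_bool (on_diag n p \<and> ?row p)) = (\<Sum>p\<in>set ps. of_bool (on_diag n p \<and> ?row p) :: int)"
      using dist by (simp add: sum_list_distinct_conv_sum_set)
    also have "\<dots> = (\<Sum>p\<in>{(1, int n), (int n, 1)}. of_bool (p \<in> set ps))"
    proof (rule sum.mono_neutral_cong)
      show "of_bool (p \<in> set ps) = 0" if "p \<in> {(1, int n), (int n, 1)} - set ps" for p
        using that by simp
      show "of_bool (on_diag n p \<and> ?row p) = 0" if "p \<in> set ps - {(1, int n), (int n, 1)}" for p
        using that by (cases p) (auto simp: on_diag_def)
    qed (auto simp: on_diag_def)
    also have "\<dots> = of_bool (d 1) + of_bool (d n)"
      using n by (simp add: d_def diag_cell_def)
    finally show ?thesis .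
  qed
  finally have w: "(\<Sum>p\<leftarrow>ps. int (card (tris n p))) + (\<Sum>p\<leftarrow>ps. int (card (?T p))) =
    3 * int (length ps) - (\<Sum>p\<leftarrow>ps. of_bool (on_diag n p)) - 4 + (of_bool (d 1) + of_bool (d n))"
    by simp
  have add: "(\<Sum>(p, q)\<leftarrow>zs. f p q) + (\<Sum>(p, q)\<leftarrow>zs. g p q) = (\<Sum>(p, q)\<leftarrow>zs. f p q + g p q)"
    for zs :: "(cell \<times> cell) list" and f g :: "cell \<Rightarrow> cell \<Rightarrow> int"
    by (induction zs) auto
  have sub1: "(\<Sum>(p, q)\<leftarrow>zs. 1 - f p q) = int (length zs) - (\<Sum>(p, q)\<leftarrow>zs. f p q)"
    for zs :: "(cell \<times> cell) list" and f :: "cell \<Rightarrow> cell \<Rightarrow> int"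
    by (induction zs) auto
  have "(\<Sum>(p, q)\<leftarrow>zip ps (tl ps). int (card (tris n p \<inter> tris n q))) + (\<Sum>(p, q)\<leftarrow>zip ps (tl ps). int (card (?T p \<inter> ?T q)))
    = (\<Sum>(p, q)\<leftarrow>zip ps (tl ps). 1 - of_bool (on_diag n p \<and> on_diag n q))"
    unfolding add
  proof (rule sum_list_zip_cong[OF ip])
    fix p q assume pq: "p \<in> set ps" "q \<in> set ps" "(p, q) \<in> hex_adj"
    then have "p \<noteq> q" using hex_adj_irrefl by metis
    then show "int (card (tris n p \<inter> tris n q)) + int (card (?T p \<inter> ?T q)) = 1 - of_bool (on_diag n p \<and> on_diag n q)"
      using pq only1[of p] only1[of q] onlyn[of p] onlyn[of q] sub by (intro weight_edge[OF _ _ n]) auto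
  qed
  then have e: "(\<Sum>(p, q)\<leftarrow>zip ps (tl ps). int (card (tris n p \<inter> tris n q))) + (\<Sum>(p, q)\<leftarrow>zip ps (tl ps). int (card (?T p \<inter> ?T q)))
    = int (length ps) - 1 - (\<Sum>(p, q)\<leftarrow>zip ps (tl ps). of_bool (on_diag n p \<and> on_diag n q))"
    using ne unfolding sub1 by (simp add: of_nat_diff Suc_le_eq)
  have "\<not> d 0" using sub by (auto simp: d_def diag_cell_def hex_board_def)
  then have "(\<Sum>q<n. of_bool (\<not> d q \<and> d (Suc q))) = of_bool (d 1) + (\<Sum>q=1..<n. of_bool (\<not> d q \<and> d (Suc q)) :: int)"
    unfolding lessThan_atLeast0 using n by (subst sum.atLeast_Suc_lessThan) simp_all
  with diag_runs[OF ip sub] have r: "(\<Sum>p\<leftarrow>ps. of_bool (on_diag n p)) - (\<Sum>(p, q)\<leftarrow>zip ps (tl ps). of_bool (on_diag n p \<and> on_diag n q))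
    = of_bool (d 1) + (\<Sum>q=1..<n. of_bool (\<not> d q \<and> d (Suc q)) :: int)"
    by (simp add: d_def)
  have E1: "int (card (empty_tris n (set ps))) = int (card (tri_index n)) - int (card (\<Union>p\<in>set ps. tris n p))"
    by (rule card_empty_tris)
  have E2: "int (card (empty_tris n (rotate_board n ` set ps))) = int (card (tri_index n)) - int (card (\<Union>p\<in>set ps. ?T p))"
    unfolding card_empty_tris by simp
  from c1 c2 w e r E1 E2 card_tri_index[of n] show ?thesis
    by (simp add: algebra_simps)
qed

section \<open>The corner of the board\<close>

lemma induced_path_neighbours:
  assumes "induced_path (us @ q # p # r # vs)"
  shows "z \<in> set (us @ q # p # r # vs) \<Longrightarrow> (p, z) \<in> hex_adj \<Longrightarrow> z = q \<or> z = r"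
    and "(p, q) \<in> hex_adj" "(p, r) \<in> hex_adj" "q \<noteq> r" "(q, r) \<notin> hex_adj"
proof -
  have tail: "induced_path (q # p # r # vs)" by (rule induced_path_appendD[OF assms])
  show "(p, q) \<in> hex_adj" using tail hex_adj_sym by auto
  show "(p, r) \<in> hex_adj" "q \<noteq> r" "(q, r) \<notin> hex_adj" using tail by auto
  assume z: "z \<in> set (us @ q # p # r # vs)" "(p, z) \<in> hex_adj"
  have "z \<notin> set us" using induced_path_split[of us q "p # r # vs" z p] assms hex_adj_sym[OF z(2)] by auto
  moreover have "z \<noteq> p" using z(2) hex_adj_irrefl by metis
  moreover have "z = r" if "z \<in> set (r # vs)"
    using induced_path_adj_hd[of p "r # vs" z] tail that z(2) by auto
  ultimately show "z = q \<or> z = r" using z(1) by auto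
qed

text \<open>The head of an induced path is adjacent to only one later cell, so it is no vertex of a
  triangle; the tail follows by induction.\<close>

lemma induced_path_no_triangle:
  assumes "induced_path ps" "p \<in> set ps" "q \<in> set ps" "r \<in> set ps"
    and "(p, q) \<in> hex_adj" "(q, r) \<in> hex_adj" "(p, r) \<in> hex_adj"
  shows False
  using assms
proof (induction ps)
  case (Cons a ps)
  have ip: "induced_path ps" using Cons.prems(1) by (cases ps) auto
  note adj = Cons.prems(5-7) Cons.prems(5-7)[THEN hex_adj_sym]
  have neq: "p \<noteq> q" "q \<noteq> r" "p \<noteq> r" using adj hex_adj_irrefl by metis+
  have hd: "z = hd ps" if "z \<in> set (a # ps)" "(a, z) \<in> hex_adj" for z
    using induced_path_adj_hd[OF Cons.prems(1) _ that(2)] that hex_adj_irrefl[of a] by auto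
  have "a \<noteq> p" using hd[of q] hd[of r] Cons.prems(2-4) adj neq by metis
  moreover have "a \<noteq> q" using hd[of p] hd[of r] Cons.prems(2-4) adj neq by metis
  moreover have "a \<noteq> r" using hd[of p] hd[of q] Cons.prems(2-4) adj neq by metis
  ultimately show ?case using Cons.IH[OF ip] Cons.prems by simp
qed simp

lemma crossing_path_inner:
  assumes "crossing_path n ps" "p \<in> set ps" "snd p \<noteq> 1" "snd p \<noteq> int n"
  obtains us q r vs where "ps = us @ q # p # r # vs"
proof -
  obtain us vs where ps: "ps = us @ p # vs" using assms(2) by (auto dest: split_list)
  have "us \<noteq> []" "vs \<noteq> []" using assms ps by (auto simp: crossing_path_def)
  then show thesis using that[of "butlast us" "last us" "hd vs" "tl vs"] ps by simp
qed

text \<open>Exactly two of the six neighbours are in the set, in clausal form. This is only correct for sets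
  without three mutually adjacent cells.\<close>
definition deg2 :: "(int \<Rightarrow> int \<Rightarrow> bool) \<Rightarrow> int \<Rightarrow> int \<Rightarrow> bool" where
  "deg2 s x y \<longleftrightarrow> (let a = s (x+1) y; b = s x (y+1); c = s (x-1) (y+1); d = s (x-1) y; e = s x (y-1); f = s (x+1) (y-1) in
     (a\<or>b\<or>c\<or>d\<or>e) \<and> (b\<or>c\<or>d\<or>e\<or>f) \<and> (c\<or>d\<or>e\<or>f\<or>a) \<and> (d\<or>e\<or>f\<or>a\<or>b) \<and> (e\<or>f\<or>a\<or>b\<or>c) \<and> (f\<or>a\<or>b\<or>c\<or>d) \<and>
     \<not> (a \<and> c \<and> e) \<and> \<not> (b \<and> d \<and> f))"

lemma crossing_path_deg2:
  assumes cp: "crossing_path n ps" and p: "(x, y) \<in> set ps" "1 < y" "y < int n"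
  shows "deg2 (\<lambda>x y. (x, y) \<in> set ps) x y"
proof -
  obtain us q r vs where ps: "ps = us @ q # (x, y) # r # vs"
    by (rule crossing_path_inner[OF cp p(1)]) (use p in auto)
  have ip: "induced_path (us @ q # (x, y) # r # vs)" using cp ps by (simp add: crossing_path_def)
  note nb = induced_path_neighbours[OF ip]
  obtain a b c d where qr: "q = (a, b)" "r = (c, d)" by (cases q; cases r)
  have mem: "(a, b) \<in> set ps" "(c, d) \<in> set ps" by (auto simp: ps qr)
  have only: "(u, v) = (a, b) \<or> (u, v) = (c, d)" if "(u, v) \<in> set ps" "((x, y), (u, v)) \<in> hex_adj" for u v
    using nb(1)[of "(u, v)"] that by (simp add: ps qr)
  define e where "e = (\<lambda>u v. (u, v) \<in> set ps)"
  have e: "e u v \<longleftrightarrow> (u = a \<and> v = b \<or> u = c \<and> v = d)" if "((x, y), (u, v)) \<in> hex_adj" for u v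
    using only[of u v] that mem by (auto simp: e_def)
  have E: "e (x + 1) y \<longleftrightarrow> (x + 1 = a \<and> y = b \<or> x + 1 = c \<and> y = d)"
    "e x (y + 1) \<longleftrightarrow> (x = a \<and> y + 1 = b \<or> x = c \<and> y + 1 = d)"
    "e (x - 1) (y + 1) \<longleftrightarrow> (x - 1 = a \<and> y + 1 = b \<or> x - 1 = c \<and> y + 1 = d)"
    "e (x - 1) y \<longleftrightarrow> (x - 1 = a \<and> y = b \<or> x - 1 = c \<and> y = d)"
    "e x (y - 1) \<longleftrightarrow> (x = a \<and> y - 1 = b \<or> x = c \<and> y - 1 = d)"
    "e (x + 1) (y - 1) \<longleftrightarrow> (x + 1 = a \<and> y - 1 = b \<or> x + 1 = c \<and> y - 1 = d)"
    by (subst e, simp add: hex_adj_iff, simp)+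
  have "((x, y), (a, b)) \<in> hex_adj" "((x, y), (c, d)) \<in> hex_adj" "((a, b), (c, d)) \<notin> hex_adj" "(a, b) \<noteq> (c, d)"
    using nb(2-5) by (simp_all add: qr)
  then have "deg2 e x y"
    unfolding deg2_def Let_def E hex_adj_iff by (elim disjE conjE; simp)
  then show ?thesis by (simp add: e_def)
qed

text \<open>The first cell has just one neighbour in the path, and that one lies in row 2 because
  row 1 is met only once.\<close>

lemma crossing_path_start:
  assumes cp: "crossing_path n ps" and n: "n \<ge> 2" and p: "(x, 1) \<in> set ps"
  shows "((x, 2) \<in> set ps) \<noteq> ((x - 1, 2) \<in> set ps)"
proof -
  have hd: "hd ps = (x, 1)" and ip: "induced_path ps" and sub: "set ps \<subseteq> hex_board n"
    and only1: "\<And>p. p \<in> set ps \<Longrightarrow> snd p = 1 \<Longrightarrow> p = hd ps"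
    and last: "snd (last ps) = int n" "ps \<noteq> []"
    using cp p by (auto simp: crossing_path_def)
  then obtain q qs where ps: "ps = (x, 1) # q # qs"
    using n by (cases ps rule: induced_path.cases) auto
  obtain a b where q: "q = (a, b)" by (cases q)
  have "((x, 1), (a, b)) \<in> hex_adj" "1 \<le> b" using ip sub by (auto simp: ps q hex_board_def)
  moreover have "b \<noteq> 1" using only1[of q] induced_path_distinct[OF ip] by (auto simp: ps q)
  ultimately have q': "q = (x, 2) \<or> q = (x - 1, 2)" by (auto simp: q hex_adj_iff)
  have "z = q" if "z \<in> set (q # qs)" "((x, 1), z) \<in> hex_adj" for z
    using induced_path_adj_hd[of "(x, 1)" "q # qs" z] ip that by (simp add: ps)
  from this[of "(x, 2)"] this[of "(x - 1, 2)"] q' show ?thesis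
    by (auto simp: ps hex_adj_iff)
qed

lemma crossing_path_end:
  assumes cp: "crossing_path n ps" and n: "n \<ge> 2" and p: "(x, int n) \<in> set ps"
  shows "(x, int n - 1) \<in> set ps \<or> (x + 1, int n - 1) \<in> set ps"
proof -
  have "(int n + 1 - x, 1) \<in> set (rev (map (rotate_board n) ps))"
    using p by (simp add: mem_rotate_image_iff) (simp add: rotate_board_def)
  from crossing_path_start[OF crossing_path_rotate[OF cp] n this]
  have "((x, int n - 1) \<in> set ps) \<noteq> ((x + 1, int n - 1) \<in> set ps)"
    by (simp add: mem_rotate_image_iff) (simp add: rotate_board_def algebra_simps)
  then show ?thesis by blast
qed

text \<open>Triangles along the two sides that meet in the acute corner (1, 1). The list is short
  enough for a propositional proof that one of them is missed, and on the board of side 9 it locates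
  the single missed triangle of a half.\<close>

abbreviation corner_tris :: "cell list" where
  "corner_tris \<equiv> [(1,1),(1,2),(1,3),(1,4),(2,1),(3,1),(4,1)]"

text \<open>The constraints near the corner involve finitely many cells, so the claim is a
  propositional tautology. The cell (1, 5) has its own premise \<open>d5\<close>, since for n = 5 it
  lies in the last row, where \<open>deg2\<close> fails.\<close>

lemma corner_sat:
  fixes s :: "int \<Rightarrow> int \<Rightarrow> bool"
  assumes up: "\<And>x y. \<not> (s x y \<and> s (x+1) y \<and> s x (y+1))"
    and down: "\<And>x y. \<not> (s x y \<and> s (x-1) (y+1) \<and> s x (y+1))"
    and deg: "\<And>x y. s x y \<Longrightarrow> 1 < y \<Longrightarrow> y < 5 \<Longrightarrow> deg2 s x y"
    and out: "\<And>x y. x < 1 \<or> y < 1 \<Longrightarrow> \<not> s x y"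
    and row1: "\<And>x x'. s x 1 \<Longrightarrow> s x' 1 \<Longrightarrow> x = x'"
    and start: "\<And>x. s x 1 \<Longrightarrow> s x 2 \<noteq> s (x-1) 2"
    and d5: "s 1 5 \<Longrightarrow> s 1 4 \<or> s 2 4 \<or> s 1 6 \<and> s 2 5"
  shows "\<exists>(x, y)\<in>set corner_tris. \<not> s x y \<and> \<not> s (x-1) (y+1) \<and> \<not> s x (y+1)"
proof -
  \<comment> \<open>Explicit lists of numerals let \<open>simp\<close> unfold the bounded
    quantifiers into ground formulas for \<open>sat\<close>.\<close>
  let ?R = "set [1,2,3,4,5,6::int]"
  have 1: "\<forall>x\<in>?R. \<forall>y\<in>?R. x + y \<le> 6 \<longrightarrow> \<not> (s x y \<and> s (x+1) y \<and> s x (y+1))" using up by blast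
  have 2: "\<forall>x\<in>?R. \<forall>y\<in>?R. 2 \<le> x \<and> x + y \<le> 6 \<longrightarrow> \<not> (s x y \<and> s (x-1) (y+1) \<and> s x (y+1))" using down by blast
  have 3: "\<forall>x\<in>?R. \<forall>y\<in>set [2,3,4]. x + y \<le> 6 \<longrightarrow> s x y \<longrightarrow> deg2 s x y" using deg by auto
  have 4: "\<forall>x\<in>?R. \<forall>y\<in>?R. x < y \<longrightarrow> \<not> (s x 1 \<and> s y 1)" using row1 by fastforce
  have 5: "\<forall>x\<in>?R. s x 1 \<longrightarrow> s x 2 \<noteq> s (x-1) 2" using start by blast
  have 6: "\<forall>x\<in>set [0,1,2,3,4,5,6,7::int]. \<not> s 0 x \<and> \<not> s x 0" using out by simp
  have 7: "s 1 5 \<longrightarrow> s 1 4 \<or> s 2 4 \<or> s 1 6 \<and> s 2 5" using d5 by blast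
  note ground = 1[simplified] 2[simplified] 3[unfolded deg2_def Let_def, simplified] 4[simplified] 5[simplified] 6[simplified]
  show ?thesis
    unfolding list.set bex_simps prod.case
    apply simp
    using ground 7 by sat
qed

text \<open>A cardinality constraint in clausal form: among any six of the eight propositions one holds, and
  if \<open>i\<close> holds, among any five.\<close>
lemma at_least_three:
  assumes "3 + of_bool i \<le> (of_bool a + of_bool b + of_bool c + of_bool d + of_bool e + of_bool f + of_bool g + of_bool h :: int)"
  shows "(a \<or> b \<or> c \<or> d \<or> e \<or> f) \<and>
    (a \<or> b \<or> c \<or> d \<or> e \<or> g) \<and>
    (a \<or> b \<or> c \<or> d \<or> e \<or> h) \<and>
    (a \<or> b \<or> c \<or> d \<or> f \<or> g) \<and>
    (a \<or> b \<or> c \<or> d \<or> f \<or> h) \<and>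
    (a \<or> b \<or> c \<or> d \<or> g \<or> h) \<and>
    (a \<or> b \<or> c \<or> e \<or> f \<or> g) \<and>
    (a \<or> b \<or> c \<or> e \<or> f \<or> h) \<and>
    (a \<or> b \<or> c \<or> e \<or> g \<or> h) \<and>
    (a \<or> b \<or> c \<or> f \<or> g \<or> h) \<and>
    (a \<or> b \<or> d \<or> e \<or> f \<or> g) \<and>
    (a \<or> b \<or> d \<or> e \<or> f \<or> h) \<and>
    (a \<or> b \<or> d \<or> e \<or> g \<or> h) \<and>
    (a \<or> b \<or> d \<or> f \<or> g \<or> h) \<and>
    (a \<or> b \<or> e \<or> f \<or> g \<or> h) \<and>
    (a \<or> c \<or> d \<or> e \<or> f \<or> g) \<and>
    (a \<or> c \<or> d \<or> e \<or> f \<or> h) \<and>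
    (a \<or> c \<or> d \<or> e \<or> g \<or> h) \<and>
    (a \<or> c \<or> d \<or> f \<or> g \<or> h) \<and>
    (a \<or> c \<or> e \<or> f \<or> g \<or> h) \<and>
    (a \<or> d \<or> e \<or> f \<or> g \<or> h) \<and>
    (b \<or> c \<or> d \<or> e \<or> f \<or> g) \<and>
    (b \<or> c \<or> d \<or> e \<or> f \<or> h) \<and>
    (b \<or> c \<or> d \<or> e \<or> g \<or> h) \<and>
    (b \<or> c \<or> d \<or> f \<or> g \<or> h) \<and>
    (b \<or> c \<or> e \<or> f \<or> g \<or> h) \<and>
    (b \<or> d \<or> e \<or> f \<or> g \<or> h) \<and>
    (c \<or> d \<or> e \<or> f \<or> g \<or> h) \<and>
    (\<not> i \<or> a \<or> b \<or> c \<or> d \<or> e) \<and>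
    (\<not> i \<or> a \<or> b \<or> c \<or> d \<or> f) \<and>
    (\<not> i \<or> a \<or> b \<or> c \<or> d \<or> g) \<and>
    (\<not> i \<or> a \<or> b \<or> c \<or> d \<or> h) \<and>
    (\<not> i \<or> a \<or> b \<or> c \<or> e \<or> f) \<and>
    (\<not> i \<or> a \<or> b \<or> c \<or> e \<or> g) \<and>
    (\<not> i \<or> a \<or> b \<or> c \<or> e \<or> h) \<and>
    (\<not> i \<or> a \<or> b \<or> c \<or> f \<or> g) \<and>
    (\<not> i \<or> a \<or> b \<or> c \<or> f \<or> h) \<and>
    (\<not> i \<or> a \<or> b \<or> c \<or> g \<or> h) \<and>
    (\<not> i \<or> a \<or> b \<or> d \<or> e \<or> f) \<and>
    (\<not> i \<or> a \<or> b \<or> d \<or> e \<or> g) \<and>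
    (\<not> i \<or> a \<or> b \<or> d \<or> e \<or> h) \<and>
    (\<not> i \<or> a \<or> b \<or> d \<or> f \<or> g) \<and>
    (\<not> i \<or> a \<or> b \<or> d \<or> f \<or> h) \<and>
    (\<not> i \<or> a \<or> b \<or> d \<or> g \<or> h) \<and>
    (\<not> i \<or> a \<or> b \<or> e \<or> f \<or> g) \<and>
    (\<not> i \<or> a \<or> b \<or> e \<or> f \<or> h) \<and>
    (\<not> i \<or> a \<or> b \<or> e \<or> g \<or> h) \<and>
    (\<not> i \<or> a \<or> b \<or> f \<or> g \<or> h) \<and>
    (\<not> i \<or> a \<or> c \<or> d \<or> e \<or> f) \<and>
    (\<not> i \<or> a \<or> c \<or> d \<or> e \<or> g) \<and>
    (\<not> i \<or> a \<or> c \<or> d \<or> e \<or> h) \<and>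
    (\<not> i \<or> a \<or> c \<or> d \<or> f \<or> g) \<and>
    (\<not> i \<or> a \<or> c \<or> d \<or> f \<or> h) \<and>
    (\<not> i \<or> a \<or> c \<or> d \<or> g \<or> h) \<and>
    (\<not> i \<or> a \<or> c \<or> e \<or> f \<or> g) \<and>
    (\<not> i \<or> a \<or> c \<or> e \<or> f \<or> h) \<and>
    (\<not> i \<or> a \<or> c \<or> e \<or> g \<or> h) \<and>
    (\<not> i \<or> a \<or> c \<or> f \<or> g \<or> h) \<and>
    (\<not> i \<or> a \<or> d \<or> e \<or> f \<or> g) \<and>
    (\<not> i \<or> a \<or> d \<or> e \<or> f \<or> h) \<and>
    (\<not> i \<or> a \<or> d \<or> e \<or> g \<or> h) \<and>
    (\<not> i \<or> a \<or> d \<or> f \<or> g \<or> h) \<and>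
    (\<not> i \<or> a \<or> e \<or> f \<or> g \<or> h) \<and>
    (\<not> i \<or> b \<or> c \<or> d \<or> e \<or> f) \<and>
    (\<not> i \<or> b \<or> c \<or> d \<or> e \<or> g) \<and>
    (\<not> i \<or> b \<or> c \<or> d \<or> e \<or> h) \<and>
    (\<not> i \<or> b \<or> c \<or> d \<or> f \<or> g) \<and>
    (\<not> i \<or> b \<or> c \<or> d \<or> f \<or> h) \<and>
    (\<not> i \<or> b \<or> c \<or> d \<or> g \<or> h) \<and>
    (\<not> i \<or> b \<or> c \<or> e \<or> f \<or> g) \<and>
    (\<not> i \<or> b \<or> c \<or> e \<or> f \<or> h) \<and>
    (\<not> i \<or> b \<or> c \<or> e \<or> g \<or> h) \<and>
    (\<not> i \<or> b \<or> c \<or> f \<or> g \<or> h) \<and>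
    (\<not> i \<or> b \<or> d \<or> e \<or> f \<or> g) \<and>
    (\<not> i \<or> b \<or> d \<or> e \<or> f \<or> h) \<and>
    (\<not> i \<or> b \<or> d \<or> e \<or> g \<or> h) \<and>
    (\<not> i \<or> b \<or> d \<or> f \<or> g \<or> h) \<and>
    (\<not> i \<or> b \<or> e \<or> f \<or> g \<or> h) \<and>
    (\<not> i \<or> c \<or> d \<or> e \<or> f \<or> g) \<and>
    (\<not> i \<or> c \<or> d \<or> e \<or> f \<or> h) \<and>
    (\<not> i \<or> c \<or> d \<or> e \<or> g \<or> h) \<and>
    (\<not> i \<or> c \<or> d \<or> f \<or> g \<or> h) \<and>
    (\<not> i \<or> c \<or> e \<or> f \<or> g \<or> h) \<and>
    (\<not> i \<or> d \<or> e \<or> f \<or> g \<or> h)"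
  using assms by (cases a; cases b; cases c; cases d; cases e; cases f; cases g; cases h; cases i) simp_all

text \<open>The premises determine the half of the board with \<open>x + y \<le> 10\<close> well enough for a propositional
  proof. The conclusion is chosen such that it contradicts its own image under
  \<open>q \<mapsto> 10 - q\<close> on the antidiagonal cells \<open>(q, 10 - q)\<close>.\<close>
lemma half_board_nine_sat:
  fixes s :: "int \<Rightarrow> int \<Rightarrow> bool"
  assumes up: "\<And>x y. \<not> (s x y \<and> s (x+1) y \<and> s x (y+1))"
    and down: "\<And>x y. \<not> (s x y \<and> s (x-1) (y+1) \<and> s x (y+1))"
    and deg: "\<And>x y. s x y \<Longrightarrow> 1 < y \<Longrightarrow> y < 9 \<Longrightarrow> deg2 s x y"
    and out: "\<And>x y. x < 1 \<or> y < 1 \<Longrightarrow> \<not> s x y"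
    and row1: "\<And>x x'. s x 1 \<Longrightarrow> s x' 1 \<Longrightarrow> x = x'"
    and start: "\<And>x. s x 1 \<Longrightarrow> s x 2 \<noteq> s (x-1) 2"
    and ex: "\<exists>x\<in>{1..9}. s x 1"
    and ne: "\<And>x y. 1 \<le> x \<Longrightarrow> 1 \<le> y \<Longrightarrow> x + y \<le> 9 \<Longrightarrow> \<not> (x = 1 \<and> y \<le> 4 \<or> y = 1 \<and> x \<le> 4) \<Longrightarrow> s x y \<or> s (x-1) (y+1) \<or> s x (y+1)"
    and corner: "\<forall>(x,y)\<in>set corner_tris. \<forall>(x',y')\<in>set corner_tris.
     (x, y) \<noteq> (x', y') \<longrightarrow> s x y \<or> s (x-1) (y+1) \<or> s x (y+1) \<or> s x' y' \<or> s (x'-1) (y'+1) \<or> s x' (y'+1)"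
    and diag: "3 + of_bool (s 9 1) \<le> (of_bool (\<not> s 1 9 \<and> s 2 8) + of_bool (\<not> s 2 8 \<and> s 3 7) + of_bool (\<not> s 3 7 \<and> s 4 6) +
      of_bool (\<not> s 4 6 \<and> s 5 5) + of_bool (\<not> s 5 5 \<and> s 6 4) + of_bool (\<not> s 6 4 \<and> s 7 3) + of_bool (\<not> s 7 3 \<and> s 8 2) +
      of_bool (\<not> s 8 2 \<and> s 9 1) :: int)"
  shows "s 8 2 \<and> \<not> s 9 1 \<and> \<not> s 7 3 \<and> (s 1 9 \<or> s 3 7 \<or> s 4 6 \<and> \<not> s 6 4)"
proof -
  let ?R = "set [1,2,3,4,5,6,7,8,9::int]"
  have 1: "\<forall>x\<in>?R. \<forall>y\<in>?R. x + y \<le> 9 \<longrightarrow> \<not> (s x y \<and> s (x+1) y \<and> s x (y+1))" using up by blast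
  have 2: "\<forall>x\<in>?R. \<forall>y\<in>?R. 2 \<le> x \<and> x + y \<le> 9 \<longrightarrow> \<not> (s x y \<and> s (x-1) (y+1) \<and> s x (y+1))" using down by blast
  have 3: "\<forall>x\<in>?R. \<forall>y\<in>?R. x + y \<le> 9 \<and> 2 \<le> y \<longrightarrow> s x y \<longrightarrow> deg2 s x y" using deg by auto
  have 4: "\<forall>x\<in>?R. \<forall>y\<in>?R. x < y \<longrightarrow> \<not> (s x 1 \<and> s y 1)" using row1 by fastforce
  have 5: "\<forall>x\<in>?R. x < 9 \<longrightarrow> s x 1 \<longrightarrow> s x 2 \<noteq> s (x-1) 2" using start by blast
  have 6: "s 1 1 \<or> s 2 1 \<or> s 3 1 \<or> s 4 1 \<or> s 5 1 \<or> s 6 1 \<or> s 7 1 \<or> s 8 1 \<or> s 9 1"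
  proof -
    have "{1..9} = ?R" by auto
    then show ?thesis using ex by simp
  qed
  have 7: "\<forall>x\<in>?R. \<forall>y\<in>?R. x + y \<le> 9 \<longrightarrow> \<not> (x = 1 \<and> y \<le> 4 \<or> y = 1 \<and> x \<le> 4) \<longrightarrow> s x y \<or> s (x-1) (y+1) \<or> s x (y+1)"
  proof (intro ballI impI)
    fix x y assume "x \<in> ?R" "y \<in> ?R" "x + y \<le> 9" "\<not> (x = 1 \<and> y \<le> 4 \<or> y = 1 \<and> x \<le> 4)"
    then show "s x y \<or> s (x-1) (y+1) \<or> s x (y+1)" using ne[of x y] by auto
  qed
  have 8: "\<forall>x\<in>set [0,1,2,3,4,5,6,7,8,9,10::int]. \<not> s 0 x \<and> \<not> s x 0" using out by simp
  note ground = 1[simplified] 2[simplified] 3[unfolded deg2_def Let_def, simplified]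
    4[simplified] 5[simplified] 7[simplified] corner[simplified]
  show ?thesis
    using ground 6 8[simplified] at_least_three[OF diag] by sat
qed

text \<open>The elementary premises shared by \<open>corner_sat\<close> and
  \<open>half_board_nine_sat\<close>.\<close>

lemma crossing_path_local:
  assumes cp: "crossing_path n ps"
  shows "\<not> ((x, y) \<in> set ps \<and> (x+1, y) \<in> set ps \<and> (x, y+1) \<in> set ps)"
    and "\<not> ((x, y) \<in> set ps \<and> (x-1, y+1) \<in> set ps \<and> (x, y+1) \<in> set ps)"
    and "x < 1 \<or> y < 1 \<Longrightarrow> (x, y) \<notin> set ps"
    and "(x, 1) \<in> set ps \<Longrightarrow> (x', 1) \<in> set ps \<Longrightarrow> x = x'"
proof -
  have ip: "induced_path ps" and sub: "set ps \<subseteq> hex_board n"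
    and only1: "\<And>p. p \<in> set ps \<Longrightarrow> snd p = 1 \<Longrightarrow> p = hd ps"
    using cp by (auto simp: crossing_path_def)
  show "\<not> ((x, y) \<in> set ps \<and> (x+1, y) \<in> set ps \<and> (x, y+1) \<in> set ps)"
    using induced_path_no_triangle[OF ip, of "(x, y)" "(x+1, y)" "(x, y+1)"] by (auto simp: hex_adj_iff)
  show "\<not> ((x, y) \<in> set ps \<and> (x-1, y+1) \<in> set ps \<and> (x, y+1) \<in> set ps)"
    using induced_path_no_triangle[OF ip, of "(x, y)" "(x-1, y+1)" "(x, y+1)"] by (auto simp: hex_adj_iff)
  show "x < 1 \<or> y < 1 \<Longrightarrow> (x, y) \<notin> set ps" using sub by (auto simp: hex_board_def)
  show "(x, 1) \<in> set ps \<Longrightarrow> (x', 1) \<in> set ps \<Longrightarrow> x = x'"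
    using only1[of "(x, 1)"] only1[of "(x', 1)"] by auto
qed

lemma corner_empty:
  assumes cp: "crossing_path n ps" and n: "n \<ge> 5"
  obtains t where "t \<in> set corner_tris" "t \<in> empty_tris n (set ps)"
proof -
  let ?s = "\<lambda>x y. (x, y) \<in> set ps"
  have "\<exists>(x, y)\<in>set corner_tris. \<not> ?s x y \<and> \<not> ?s (x-1) (y+1) \<and> \<not> ?s x (y+1)"
  proof (rule corner_sat)
    show "deg2 ?s x y" if "?s x y" "1 < y" "y < 5" for x y
      using crossing_path_deg2[OF cp that(1,2)] that n by simp
    show "?s x 2 \<noteq> ?s (x - 1) 2" if "?s x 1" for x
      using crossing_path_start[OF cp _ that] n by simp
    show "?s 1 4 \<or> ?s 2 4 \<or> ?s 1 6 \<and> ?s 2 5" if "?s 1 5"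
    proof (cases "n = 5")
      case True
      then show ?thesis using crossing_path_end[OF cp, of 1] that by simp blast
    next
      case False
      then have "deg2 ?s 1 5" using crossing_path_deg2[OF cp that] n by simp
      moreover have "\<not> ?s 0 5" "\<not> ?s 0 6" using crossing_path_local(3)[OF cp] by auto
      ultimately show ?thesis unfolding deg2_def Let_def by simp blast
    qed
  qed (use crossing_path_local[OF cp] in blast)+
  then obtain x y where xy: "(x, y) \<in> set corner_tris" and e: "\<not> ?s x y" "\<not> ?s (x-1) (y+1)" "\<not> ?s x (y+1)"
    by blast
  have "1 \<le> x \<and> 1 \<le> y \<and> x + y \<le> 5" using xy by auto
  then have "(x, y) \<in> empty_tris n (set ps)"
    using e n by (simp add: empty_tris_def tri_index_def tri_cells_def)
  then show thesis using that[OF xy] by blast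
qed

lemma card_empty_tris_pos:
  assumes "crossing_path n ps" "n \<ge> 5"
  shows "card (empty_tris n (set ps)) \<ge> 1"
proof -
  have "finite (empty_tris n (set ps))" by (simp add: empty_tris_def)
  moreover have "empty_tris n (set ps) \<noteq> {}" using corner_empty[OF assms] by blast
  ultimately show ?thesis by (simp add: Suc_le_eq card_gt_0_iff)
qed

section \<open>The antidiagonal\<close>

text \<open>Rises at two consecutive positions exclude each other, so each of the m pairs {2 i - 1,
  2 i} of positions contributes at most one.\<close>

lemma transitions_le:
  fixes d :: "nat \<Rightarrow> bool"
  shows "(\<Sum>q=1..<2*m+1. of_bool (\<not> d q \<and> d (Suc q))) \<le> int m"
proof (induction m)
  case (Suc m)
  have "(\<Sum>q=1..<2*Suc m+1. of_bool (\<not> d q \<and> d (Suc q))) = (\<Sum>q=1..<2*m+1. of_bool (\<not> d q \<and> d (Suc q)) :: int)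
      + of_bool (\<not> d (2*m+1) \<and> d (2*m+2)) + of_bool (\<not> d (2*m+2) \<and> d (2*m+3))"
    by (simp add: numeral_3_eq_3)
  then show ?case using Suc by (auto simp: of_bool_def split: if_splits)
qed simp

text \<open>For even n the unpaired last rise forces \<open>d n\<close> and is paid for by the
  subtracted term.\<close>

lemma transitions_le':
  fixes d :: "nat \<Rightarrow> bool"
  assumes "n \<ge> 1"
  shows "(\<Sum>q=1..<n. of_bool (\<not> d q \<and> d (Suc q))) - of_bool (d n) \<le> int ((n - 1) div 2)"
proof (cases "odd n")
  case True
  then obtain m where "n = 2 * m + 1" by (elim oddE)
  then show ?thesis using transitions_le[of d m] by (simp add: of_bool_def)
next
  case False
  then have "even n" by simp
  then obtain k where "n = 2 * k" by (elim evenE)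
  then obtain m where n: "n = Suc (2 * m + 1)" using assms by (cases k) auto
  have "(\<Sum>q=1..<n. of_bool (\<not> d q \<and> d (Suc q))) =
      (\<Sum>q=1..<2*m+1. of_bool (\<not> d q \<and> d (Suc q)) :: int) + of_bool (\<not> d (2*m+1) \<and> d n)"
    by (simp add: n)
  then show ?thesis using transitions_le[of d m] by (simp add: n of_bool_def)
qed

text \<open>Every pair of positions must contain a rise. As the value at the right end is false, the
  rise is at the first position of the last pair, and the alternation propagates to the
  left.\<close>

lemma transitions_eq:
  fixes d :: "nat \<Rightarrow> bool"
  assumes "(\<Sum>q=1..<2*m+1. of_bool (\<not> d q \<and> d (Suc q))) = int m" "\<not> d (2*m+1)"
    and "1 \<le> q" "q \<le> 2*m+1"
  shows "d q \<longleftrightarrow> even q"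
  using assms
proof (induction m)
  case 0
  then show ?case by (cases "q = 1") auto
next
  case (Suc m)
  have "(\<Sum>q=1..<2*Suc m+1. of_bool (\<not> d q \<and> d (Suc q))) = (\<Sum>q=1..<2*m+1. of_bool (\<not> d q \<and> d (Suc q)) :: int)
      + of_bool (\<not> d (2*m+1) \<and> d (2*m+2)) + of_bool (\<not> d (2*m+2) \<and> d (2*m+3))"
    by (simp add: numeral_3_eq_3)
  moreover have "\<not> d (2*m+3)" using Suc.prems(2) by (simp add: numeral_3_eq_3)
  ultimately have "(\<Sum>q=1..<2*m+1. of_bool (\<not> d q \<and> d (Suc q))) = int m" "\<not> d (2*m+1)" "d (2*m+2)"
    using Suc.prems(1) transitions_le[of d m] by (auto simp: of_bool_def split: if_splits)
  then show ?case using Suc.IH Suc.prems(3,4) \<open>\<not> d (2*m+3)\<close>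
    by (cases "q \<le> 2*m+1"; cases "q = 2*m+2"; cases "q = 2*m+3") auto
qed

section \<open>Crossings of the antidiagonal and the parity condition in a half\<close>

definition below :: "nat \<Rightarrow> cell \<Rightarrow> bool" where
  "below n p \<longleftrightarrow> fst p + snd p \<le> int n"

text \<open>The two neighbours of y on the same side of the antidiagonal are adjacent to each other,
  so x and z cannot be both of them.\<close>

lemma diag_crossing_sides:
  assumes "(x, y) \<in> hex_adj" "(y, z) \<in> hex_adj" "x \<noteq> z" "(x, z) \<notin> hex_adj" "on_diag n y" "\<not> on_diag n x" "\<not> on_diag n z"
  shows "below n x \<longleftrightarrow> \<not> below n z"
proof -
  obtain a b c d e f where xyz: "x = (a, b)" "y = (c, d)" "z = (e, f)" by (cases x; cases y; cases z)
  have "(y, x) \<in> hex_adj" using assms(1) by (rule hex_adj_sym)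
  then have x: "x = (c+1, d) \<or> x = (c-1, d) \<or> x = (c, d+1) \<or> x = (c, d-1)"
    using assms(5,6) by (auto simp: xyz hex_adj_iff on_diag_def)
  have z: "z = (c+1, d) \<or> z = (c-1, d) \<or> z = (c, d+1) \<or> z = (c, d-1)"
    using assms(2,5,7) by (auto simp: xyz hex_adj_iff on_diag_def)
  have "c + d = int n + 1" using assms(5) by (simp add: xyz on_diag_def)
  with x z assms(3,4) show ?thesis
    by (elim disjE; simp add: hex_adj_iff below_def)
qed

lemma hex_adj_diag_step: "(x, y) \<in> hex_adj \<Longrightarrow> below n x \<Longrightarrow> below n y \<or> on_diag n y"
  by (cases x; cases y) (auto simp: hex_adj_iff below_def on_diag_def)

text \<open>The number \<open>u\<close> counts the antidiagonal cells from which the path continues into the half away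
  from \<open>(1, 1)\<close>. Isolated antidiagonal cells are crossings, so these alternate with the crossings in
  the opposite direction.\<close>
lemma diag_crossings:
  assumes "induced_path ps" "ps \<noteq> []" "\<not> below n (last ps)" "\<not> on_diag n (last ps)"
    and "\<And>p q. p \<in> set ps \<Longrightarrow> q \<in> set ps \<Longrightarrow> (p, q) \<in> hex_adj \<Longrightarrow> \<not> (on_diag n p \<and> on_diag n q)"
  shows "\<exists>u. 3 * (\<Sum>p\<leftarrow>ps. of_bool (below n p)) + (\<Sum>p\<leftarrow>ps. of_bool (on_diag n p))
      - (\<Sum>(p, q)\<leftarrow>zip ps (tl ps). of_bool ((below n p \<or> on_diag n p) \<and> (below n q \<or> on_diag n q)))
      = 2 * (\<Sum>p\<leftarrow>ps. of_bool (below n p)) + (u :: int)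
    \<and> (\<Sum>p\<leftarrow>ps. of_bool (on_diag n p)) = 2 * u - of_bool (below n (hd ps) \<or> on_diag n (hd ps) \<and> \<not> below n (hd (tl ps)))"
  using assms
proof (induction ps rule: induced_path.induct)
  case (2 p)
  then show ?case by simp
next
  case (3 p q ps)
  let ?X = "\<lambda>ps. 3 * (\<Sum>p\<leftarrow>ps. of_bool (below n p)) + (\<Sum>p\<leftarrow>ps. of_bool (on_diag n p))
      - (\<Sum>(p, q)\<leftarrow>zip ps (tl ps). of_bool ((below n p \<or> on_diag n p) \<and> (below n q \<or> on_diag n q))) :: int"
  let ?L = "\<lambda>ps. (\<Sum>p\<leftarrow>ps. of_bool (below n p)) :: int"
  let ?D = "\<lambda>ps. (\<Sum>p\<leftarrow>ps. of_bool (on_diag n p)) :: int"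
  have "\<exists>u. ?X (q # ps) = 2 * ?L (q # ps) + u \<and>
    ?D (q # ps) = 2 * u - of_bool (below n (hd (q # ps)) \<or> on_diag n (hd (q # ps)) \<and> \<not> below n (hd (tl (q # ps))))"
  proof (rule "3.IH")
    show "induced_path (q # ps)" using "3.prems"(1) by simp
    show "\<not> below n (last (q # ps))" "\<not> on_diag n (last (q # ps))" using "3.prems"(3,4) by simp_all
    show "\<not> (on_diag n x \<and> on_diag n y)" if "x \<in> set (q # ps)" "y \<in> set (q # ps)" "(x, y) \<in> hex_adj" for x y
      using "3.prems"(5)[of x y] that by simp
  qed simp
  then obtain u where u: "?X (q # ps) = 2 * ?L (q # ps) + u"
    "?D (q # ps) = 2 * u - of_bool (below n q \<or> on_diag n q \<and> \<not> below n (hd ps))" by auto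
  have adj: "(p, q) \<in> hex_adj" using "3.prems"(1) by simp
  have X: "?X (p # q # ps) = ?X (q # ps) + 3 * of_bool (below n p) + of_bool (on_diag n p)
      - of_bool ((below n p \<or> on_diag n p) \<and> (below n q \<or> on_diag n q))" by simp
  have L: "?L (p # q # ps) = ?L (q # ps) + of_bool (below n p)" by simp
  have D: "?D (p # q # ps) = ?D (q # ps) + of_bool (on_diag n p)" by simp
  have nd: "\<not> (on_diag n p \<and> on_diag n q)" using "3.prems"(5)[of p q] adj by simp
  have excl: "\<not> (below n p \<and> on_diag n p)" "\<not> (below n q \<and> on_diag n q)" by (auto simp: below_def on_diag_def)
  \<comment> \<open>The last cell is off the antidiagonal, so q has a successor
    \<open>hd ps\<close>; being isolated, q is a crossing.\<close>
  have cross: "below n p \<longleftrightarrow> \<not> below n (hd ps)" if q: "on_diag n q"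
  proof -
    have "ps \<noteq> []" using "3.prems"(4) q by auto
    then obtain r rs where ps: "ps = r # rs" by (cases ps) auto
    have "(q, r) \<in> hex_adj" "(p, r) \<notin> hex_adj" "p \<noteq> r" using "3.prems"(1) by (auto simp: ps)
    moreover have "\<not> on_diag n r" using "3.prems"(5)[of q r] q \<open>(q, r) \<in> hex_adj\<close> by (simp add: ps)
    ultimately show ?thesis using diag_crossing_sides[OF adj] nd q by (simp add: ps)
  qed
  have up: "below n q \<or> on_diag n q" if "below n p" using hex_adj_diag_step[OF adj that] .
  have down: "below n p \<or> on_diag n p" if "below n q" using hex_adj_diag_step[OF hex_adj_sym[OF adj] that] .
  \<comment> \<open>\<open>w\<close> is 1 if p is one more cell from which the path leaves the half.
    Facts \<open>1\<close> and \<open>2\<close> are the changes of the two claimed equations when p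
    is prepended.\<close>
  define w where "w = (of_bool (on_diag n p \<and> \<not> below n q) :: int)"
  have 1: "of_bool (below n p) + of_bool (on_diag n p) - of_bool ((below n p \<or> on_diag n p) \<and> (below n q \<or> on_diag n q)) = w"
    using nd excl cross up down unfolding w_def
    by (cases "below n p"; cases "below n q"; cases "on_diag n p"; cases "on_diag n q") simp_all
  have 2: "of_bool (on_diag n p) - of_bool (below n q \<or> on_diag n q \<and> \<not> below n (hd ps)) =
      2 * w - of_bool (below n p \<or> on_diag n p \<and> \<not> below n q)"
    using nd excl cross up down unfolding w_def
    by (cases "below n p"; cases "below n q"; cases "on_diag n p"; cases "on_diag n q"; cases "below n (hd ps)") simp_all
  have arith: "a - b = 2 * w - c \<Longrightarrow> 2 * u - b + a = 2 * (u + w) - c" for a b c :: int by simp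
  have "?X (p # q # ps) = 2 * ?L (p # q # ps) + (u + w)"
    using 1 u(1) X L by linarith
  moreover have "?D (p # q # ps) = 2 * (u + w) - of_bool (below n p \<or> on_diag n p \<and> \<not> below n q)"
    unfolding D u(2) using 2 by (rule arith)
  ultimately show ?case unfolding list.sel by blast
qed simp

text \<open>Equality in \<open>transitions_le\<close> makes the occupied antidiagonal columns the
  even ones. All m antidiagonal cells are then isolated crossings, and as the path begins in the
  half of (1, 1) and ends in the other, u of them lead out and u - 1 back. With l cells below the
  antidiagonal, 2 l + u - 2 triangles of this half are met; the 2 is lost at the first cell.\<close>

lemma crossing_path_alternating:
  assumes cp: "crossing_path n ps" and n: "n = 2 * m + 1" "m \<ge> 1"
    and G: "(\<Sum>q=1..<n. of_bool (\<not> diag_cell n (set ps) q \<and> diag_cell n (set ps) (Suc q))) = int m"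
    and dn: "\<not> diag_cell n (set ps) n"
  obtains u l where "int m = 2 * u - 1"
    "int (card (tri_index n)) - int (card (empty_tris n (set ps))) = 2 * l + u - 2"
proof -
  let ?d = "diag_cell n (set ps)"
  have ip: "induced_path ps" and ne: "ps \<noteq> []" and sub: "set ps \<subseteq> hex_board n"
    and hd1: "snd (hd ps) = 1" and lastn: "snd (last ps) = int n"
    and only1: "\<And>p. p \<in> set ps \<Longrightarrow> snd p = 1 \<Longrightarrow> p = hd ps"
    using cp by (auto simp: crossing_path_def)
  note dist = induced_path_distinct[OF ip]
  have alt: "?d q \<longleftrightarrow> even q" if "1 \<le> q" "q \<le> n" for q
    using transitions_eq[of ?d m q] G dn that n by simp
  have even: "even a" if "(a, b) \<in> set ps" "on_diag n (a, b)" for a b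
  proof -
    have a: "1 \<le> a" "a \<le> int n" "b = int n + 1 - a" using that sub by (auto simp: hex_board_def on_diag_def)
    then have "?d (nat a)" using that by (simp add: diag_cell_def)
    then have "even (nat a)" using alt[of "nat a"] a by auto
    then show ?thesis using a by (simp add: even_nat_iff)
  qed
  have iso: "\<not> (on_diag n p \<and> on_diag n q)" if pq: "p \<in> set ps" "q \<in> set ps" "(p, q) \<in> hex_adj" for p q
  proof
    assume D: "on_diag n p \<and> on_diag n q"
    obtain a b c d where "p = (a, b)" "q = (c, d)" by (cases p; cases q)
    then have "even a" "even c" "c = a + 1 \<or> c = a - 1"
      using pq D even by (auto simp: hex_adj_iff on_diag_def)
    then show False by auto
  qed
  have below_hd: "below n (hd ps)"
  proof -
    obtain a where a: "hd ps = (a, 1)" using hd1 by (cases "hd ps") auto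
    then have "(a, 1) \<in> set ps" using hd_in_set[OF ne] by simp
    then have "a \<le> int n" "a \<noteq> int n" using sub dn by (auto simp: hex_board_def diag_cell_def)
    then show ?thesis by (simp add: a below_def)
  qed
  have last: "\<not> below n (last ps)" "\<not> on_diag n (last ps)"
  proof -
    obtain a where a: "last ps = (a, int n)" using lastn by (cases "last ps") auto
    then have mem: "(a, int n) \<in> set ps" using last_in_set[OF ne] by simp
    have "\<not> ?d 1" using alt[of 1] n by simp
    then have "a \<ge> 1" "a \<noteq> 1" using mem sub by (auto simp: hex_board_def diag_cell_def)
    then show "\<not> below n (last ps)" "\<not> on_diag n (last ps)" by (auto simp: a below_def on_diag_def)
  qed
  let ?L = "(\<Sum>p\<leftarrow>ps. of_bool (below n p)) :: int"
  let ?D = "(\<Sum>p\<leftarrow>ps. of_bool (on_diag n p)) :: int"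
  let ?E = "(\<Sum>(p, q)\<leftarrow>zip ps (tl ps). of_bool ((below n p \<or> on_diag n p) \<and> (below n q \<or> on_diag n q))) :: int"
  have "\<exists>u. 3 * ?L + ?D - ?E = 2 * ?L + u \<and>
    ?D = 2 * u - of_bool (below n (hd ps) \<or> on_diag n (hd ps) \<and> \<not> below n (hd (tl ps)))"
    by (rule diag_crossings[OF ip ne last]) (rule iso)
  then obtain u where u: "3 * ?L + ?D - ?E = 2 * ?L + u"
    "?D = 2 * u - of_bool (below n (hd ps) \<or> on_diag n (hd ps) \<and> \<not> below n (hd (tl ps)))"
    by (elim exE conjE)
  have "(\<Sum>(p, q)\<leftarrow>zip ps (tl ps). of_bool (on_diag n p \<and> on_diag n q)) = (\<Sum>(p, q)\<leftarrow>zip ps (tl ps). 0 :: int)"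
    using iso by (intro sum_list_zip_cong[OF ip]) simp
  also have "(\<Sum>(p, q)\<leftarrow>zs. 0 :: int) = 0" for zs :: "(cell \<times> cell) list"
    by (induction zs) auto
  finally have "?D = (\<Sum>q<n. of_bool (\<not> ?d q \<and> ?d (Suc q)))"
    using diag_runs[OF ip sub] by simp
  also have "\<dots> = of_bool (\<not> ?d 0 \<and> ?d (Suc 0)) + int m"
    unfolding lessThan_atLeast0 G[symmetric] using n by (subst sum.atLeast_Suc_lessThan) simp_all
  finally have "?D = int m" using alt[of 1] n by simp
  have "(\<Sum>p\<leftarrow>ps. int (card (tris n p))) = (\<Sum>p\<leftarrow>ps. 3 * of_bool (below n p) + of_bool (on_diag n p) - 2 * of_bool (p = hd ps))"
  proof (intro arg_cong[of _ _ sum_list] map_cong refl)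
    fix p assume p: "p \<in> set ps"
    obtain a b where ab: "p = (a, b)" by (cases p)
    have bds: "1 \<le> a" "a \<le> int n" "1 \<le> b" "b \<le> int n" using p sub by (auto simp: ab hex_board_def)
    have "p = hd ps \<longleftrightarrow> b = 1" using only1[OF p] hd1 by (metis ab snd_conv)
    moreover have "b = 1 \<Longrightarrow> below n p" using only1[OF p] below_hd by (simp add: ab)
    ultimately show "int (card (tris n p)) = 3 * of_bool (below n p) + of_bool (on_diag n p) - 2 * of_bool (p = hd ps)"
      using bds by (auto simp: ab card_tris tri_index_def below_def on_diag_def of_bool_def)
  qed
  also have "\<dots> = 3 * ?L + ?D - 2 * (\<Sum>p\<leftarrow>ps. of_bool (p = hd ps))"
    by (simp add: sum_list_addf sum_list_subtractf sum_list_const_mult)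
  also have "(\<Sum>p\<leftarrow>ps. of_bool (p = hd ps)) = (\<Sum>p\<in>set ps. of_bool (p = hd ps) :: int)"
    using dist by (simp add: sum_list_distinct_conv_sum_set)
  also have "\<dots> = 1" using ne by (simp add: of_bool_def)
  finally have c: "(\<Sum>p\<leftarrow>ps. int (card (tris n p))) = 3 * ?L + ?D - 2" by simp
  have e: "(\<Sum>(p, q)\<leftarrow>zip ps (tl ps). int (card (tris n p \<inter> tris n q))) = ?E"
  proof (rule sum_list_zip_cong[OF ip])
    fix p q assume pq: "p \<in> set ps" "q \<in> set ps" "(p, q) \<in> hex_adj"
    obtain a b c d where ab: "p = (a, b)" "q = (c, d)" by (cases p; cases q)
    have bds: "1 \<le> a" "1 \<le> b" "1 \<le> c" "1 \<le> d" using pq sub by (auto simp: ab hex_board_def)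
    have "p \<noteq> q" using pq(3) hex_adj_irrefl by metis
    then have "\<not> (b = 1 \<and> d = 1)" using only1[OF pq(1)] only1[OF pq(2)] ab by (metis snd_conv)
    moreover have "\<not> (a + b = int n + 1 \<and> c + d = int n + 1)" using iso[OF pq] by (simp add: ab on_diag_def)
    ultimately have "(1 \<le> max a c \<and> 1 \<le> max b d - 1 \<and> max a c + (max b d - 1) \<le> int n) \<longleftrightarrow>
        (a + b \<le> int n + 1 \<and> c + d \<le> int n + 1)"
      using bds pq(3) unfolding ab hex_adj_iff by (elim disjE conjE; auto simp: max_def)
    then show "int (card (tris n p \<inter> tris n q)) = of_bool ((below n p \<or> on_diag n p) \<and> (below n q \<or> on_diag n q))"
      unfolding ab tris_Int_adj[OF pq(3)[unfolded ab]]
      by (auto simp: Int_insert_left tri_index_def below_def on_diag_def)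
  qed
  have "int (card (\<Union>p\<in>set ps. tris n p)) = 2 * ?L + u - 2"
    using card_UN_induced_path[OF ip _ tris_disjoint, of n] c e u(1) by simp
  then show thesis
    using that[of u ?L] card_empty_tris[of n "set ps"] u(2) below_hd \<open>?D = int m\<close> by simp
qed

lemma crossing_path_length_le:
  assumes "crossing_path n ps" "n \<ge> 5"
  shows "2 * int (length ps) \<le> int n * int n - int n + 1 + int ((n - 1) div 2)"
  using crossing_path_count[OF assms(1)] transitions_le'[of n "diag_cell n (set ps)"]
    card_empty_tris_pos[OF assms] card_empty_tris_pos[OF crossing_path_rotate[OF assms(1)] assms(2)] assms(2)
  by simp

section \<open>The upper bound\<close>

text \<open>Four times the bound is an integer, so the cases can be settled by integer
  arithmetic.\<close>

definition hex_bound4 :: "nat \<Rightarrow> int" where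
  "hex_bound4 n = 2 * (int n * int n) - int n +
    (if n mod 4 = 0 then 0 else if n mod 4 = 1 then -1 else if n mod 4 = 2 then -2 else if n mod 8 = 3 then -3 else 1)"

lemma hex_bound_conv: "hex_bound n = real_of_int (hex_bound4 n) / 4"
  by (simp add: hex_bound_def hex_bound4_def power2_eq_square field_simps)

text \<open>Compared with \<open>crossing_path_count\<close>, the premise \<open>eq\<close> makes
  the number of runs maximal, so the last antidiagonal cell is free and
  \<open>crossing_path_alternating\<close> applies. The first equation excludes even m, the second
  is a condition modulo 4 on \<open>e1\<close>.\<close>

lemma crossing_path_equality:
  assumes cp: "crossing_path n ps" and n: "n = 2 * m + 1" "n \<ge> 5"
    and eq: "2 * int (length ps) = int n * int n - int n + 3 + int m - int e1 - int e2"
    and e: "e1 = card (empty_tris n (set ps))" "e2 = card (empty_tris n (rotate_board n ` set ps))"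
  obtains u l where "int m = 2 * u - 1" "int n * (int n - 1) - 2 * int e1 = 4 * l + 2 * u - 4"
proof -
  let ?d = "diag_cell n (set ps)"
  have "(\<Sum>q=1..<n. of_bool (\<not> ?d q \<and> ?d (Suc q))) - of_bool (?d n) = int m"
    using crossing_path_count[OF cp] n(2) eq e by simp
  moreover have "(\<Sum>q=1..<n. of_bool (\<not> ?d q \<and> ?d (Suc q))) \<le> int m"
    using transitions_le[of ?d m] n(1) by simp
  ultimately have dn: "\<not> ?d n" and G: "(\<Sum>q=1..<n. of_bool (\<not> ?d q \<and> ?d (Suc q))) = int m"
    by (cases "?d n"; simp)+
  have "m \<ge> 1" using n by simp
  then obtain u l where "int m = 2 * u - 1"
      "int (card (tri_index n)) - int (card (empty_tris n (set ps))) = 2 * l + u - 2"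
    using crossing_path_alternating[OF cp n(1) _ G dn] by blast
  then show thesis using that[of u l] card_tri_index[of n] e(1) by simp
qed

lemma crossing_path_length_upper:
  assumes cp: "crossing_path n ps" and n: "n \<ge> 5"
  shows "4 * int (length ps) \<le> hex_bound4 n"
proof -
  define j where "j = n div 4"
  define J where "J = int j"
  \<comment> \<open>The only product becomes an atom, so that the rest is linear in J and Q.\<close>
  define Q where "Q = J * J"
  define k where "k = int (length ps)"
  have le: "2 * k \<le> int n * int n - int n + 1 + int ((n - 1) div 2)"
    using crossing_path_length_le[OF assms] by (simp add: k_def)
  have nj: "n = 4 * j + n mod 4" by (simp add: j_def)
  have half: "(n - 1) div 2 = i" if "2 * i \<le> n - 1" "n - 1 < 2 * Suc i" for i
    using that by (rule div_nat_eqI)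
  have "n mod 4 < 4" by simp
  then consider "n mod 4 = 0" | "n mod 4 = 1" | "n mod 4 = 2" | "n mod 4 = 3" by linarith
  then have "4 * k \<le> hex_bound4 n"
  proof cases
    case 1
    then have nr: "n = 4 * j" using nj by simp
    then have "(n - 1) div 2 = 2 * j - 1" using n by (intro half) simp_all
    then have N: "int n = 4 * J" "int ((n - 1) div 2) = 2 * J - 1" using nr n by (simp_all add: J_def)
    have "int n * int n = 16 * Q" by (simp add: N(1) Q_def)
    moreover from this have "2 * k \<le> 16 * Q - 2 * J" using le N by simp
    ultimately show ?thesis using 1 N by (simp add: hex_bound4_def)
  next
    case 2
    then have nr: "n = 4 * j + 1" using nj by simp
    then have "(n - 1) div 2 = 2 * j" using n by (intro half) simp_all
    then have N: "int n = 4 * J + 1" "int ((n - 1) div 2) = 2 * J" using nr n by (simp_all add: J_def)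
    have "int n * int n = 16 * Q + 8 * J + 1" by (simp add: N(1) Q_def algebra_simps)
    moreover from this have "2 * k \<le> 16 * Q + 6 * J + 1" using le N by simp
    \<comment> \<open>The left side \<open>2 * k\<close> is even and the bound is odd, which saves
      1. The case n mod 4 = 2 is rounded in the same way.\<close>
    then have "k \<le> 8 * Q + 3 * J" by presburger
    ultimately show ?thesis using 2 N by (simp add: hex_bound4_def)
  next
    case 3
    then have nr: "n = 4 * j + 2" using nj by simp
    then have "(n - 1) div 2 = 2 * j" using n by (intro half) simp_all
    then have N: "int n = 4 * J + 2" "int ((n - 1) div 2) = 2 * J" using nr n by (simp_all add: J_def)
    have "int n * int n = 16 * Q + 16 * J + 4" by (simp add: N(1) Q_def algebra_simps)
    moreover from this have "2 * k \<le> 16 * Q + 14 * J + 3" using le N by simp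
    then have "k \<le> 8 * Q + 7 * J + 1" by presburger
    ultimately show ?thesis using 3 N by (simp add: hex_bound4_def)
  next
    case 4
    then have nr: "n = 4 * j + 3" using nj by simp
    then have "(n - 1) div 2 = 2 * j + 1" using n by (intro half) simp_all
    then have N: "int n = 4 * J + 3" "int ((n - 1) div 2) = 2 * J + 1" using nr n by (simp_all add: J_def)
    have NN: "int n * int n = 16 * Q + 24 * J + 9" by (simp add: N(1) Q_def algebra_simps)
    show ?thesis
    proof (cases "n mod 8 = 3")
      case False
      have "2 * k \<le> 16 * Q + 22 * J + 8" using le N NN by simp
      then show ?thesis using False 4 N NN by (simp add: hex_bound4_def)
    next
      case True
      \<comment> \<open>Equality would need \<open>e1 = e2 = 1\<close> and the maximal number of
        runs, which brings in the parity condition of \<open>crossing_path_equality\<close>.\<close>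
      have "2 * k \<noteq> 16 * Q + 22 * J + 8"
      proof
        assume k: "2 * k = 16 * Q + 22 * J + 8"
        define e1 where "e1 = card (empty_tris n (set ps))"
        define e2 where "e2 = card (empty_tris n (rotate_board n ` set ps))"
        have pos: "e1 \<ge> 1" "e2 \<ge> 1"
          using card_empty_tris_pos[OF assms] card_empty_tris_pos[OF crossing_path_rotate[OF cp] n]
          by (simp_all add: e1_def e2_def)
        have "2 * k \<le> int n * int n - int n + 3 + int ((n - 1) div 2) - int e1 - int e2"
          using crossing_path_count[OF cp] transitions_le'[of n "diag_cell n (set ps)"] n
          by (simp add: k_def e1_def e2_def)
        then have "e1 = 1" "e2 = 1" using pos k N NN by linarith+
        moreover have nm: "n = 2 * ((n - 1) div 2) + 1" using N by linarith
        have "2 * int (length ps) = int n * int n - int n + 3 + int ((n - 1) div 2) - int e1 - int e2"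
          using k N NN \<open>e1 = 1\<close> \<open>e2 = 1\<close> by (simp add: k_def)
        then obtain u l where ul: "int ((n - 1) div 2) = 2 * u - 1" "int n * (int n - 1) - 2 * int e1 = 4 * l + 2 * u - 4"
          using crossing_path_equality[OF cp nm n _ e1_def e2_def] by blast
        have "2 * u = 2 * J + 2" using ul(1) N by simp
        moreover have "int n * (int n - 1) = 16 * Q + 20 * J + 6" by (simp add: N(1) Q_def algebra_simps)
        ultimately have "16 * Q + 20 * J + 4 = 4 * l + 2 * J - 2" using ul(2) by simp
        \<comment> \<open>Modulo 4 the left side of the last equation is 0 and the right side is 2 J
          - 2, which is 2 for even J.\<close>
        moreover have "even J" using True nr by (simp add: J_def) presburger
        ultimately show False by presburger
      qed
      moreover have "2 * k \<le> 16 * Q + 22 * J + 8" using le N NN by simp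
      ultimately have "k \<le> 8 * Q + 11 * J + 3" by presburger
      then show ?thesis using N NN 4 True by (simp add: hex_bound4_def)
    qed
  qed
  then show ?thesis by (simp add: k_def)
qed

text \<open>By \<open>corner_empty\<close> the only missed triangle of the half is one of
  \<open>corner_tris\<close>, so all others are met. This yields the premises \<open>ne\<close> and
  \<open>corner\<close> of \<open>half_board_nine_sat\<close>, and \<open>tr\<close> yields
  \<open>diag\<close>.\<close>

lemma half_board_nine:
  assumes cp: "crossing_path 9 ps" and E: "card (empty_tris 9 (set ps)) = 1"
    and tr: "(\<Sum>q=1..<9. of_bool (\<not> diag_cell 9 (set ps) q \<and> diag_cell 9 (set ps) (Suc q))) - of_bool (diag_cell 9 (set ps) 9) = (3 :: int)"
  shows "(8, 2) \<in> set ps \<and> (9, 1) \<notin> set ps \<and> (7, 3) \<notin> set ps \<and>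
    ((1, 9) \<in> set ps \<or> (3, 7) \<in> set ps \<or> (4, 6) \<in> set ps \<and> (6, 4) \<notin> set ps)"
proof -
  let ?s = "\<lambda>x y. (x, y) \<in> set ps"
  obtain c where c: "c \<in> set corner_tris" "c \<in> empty_tris 9 (set ps)" using corner_empty[OF cp] by auto
  have single: "t = c" if "t \<in> empty_tris 9 (set ps)" for t
    using E c(2) that by (metis card_1_singletonE singletonD)
  have emptyI: "(x, y) \<in> empty_tris 9 (set ps)"
    if "1 \<le> x" "1 \<le> y" "x + y \<le> 9" "\<not> ?s x y" "\<not> ?s (x-1) (y+1)" "\<not> ?s x (y+1)" for x y
    using that by (simp add: empty_tris_def tri_index_def tri_cells_def)
  show ?thesis
  proof (rule half_board_nine_sat[of ?s])
    show "deg2 ?s x y" if "?s x y" "1 < y" "y < 9" for x y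
      using crossing_path_deg2[OF cp that(1,2)] that by simp
    show "?s x 2 \<noteq> ?s (x - 1) 2" if "?s x 1" for x
      using crossing_path_start[OF cp _ that] by simp
    show "\<exists>x\<in>{1..9}. ?s x 1"
    proof -
      obtain a b where ab: "hd ps = (a, b)" by (cases "hd ps")
      have "(a, b) \<in> set ps" "b = 1" "(a, b) \<in> hex_board 9"
        using cp hd_in_set[of ps] ab by (auto simp: crossing_path_def)
      then show ?thesis by (auto simp: hex_board_def)
    qed
    show "?s x y \<or> ?s (x-1) (y+1) \<or> ?s x (y+1)"
      if "1 \<le> x" "1 \<le> y" "x + y \<le> 9" "\<not> (x = 1 \<and> y \<le> 4 \<or> y = 1 \<and> x \<le> 4)" for x y
    proof (rule ccontr)
      assume "\<not> ?thesis"
      then have "(x, y) = c" using single[OF emptyI[OF that(1-3)]] by blast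
      then show False using c(1) that(4) by auto
    qed
    have pair: "?s x y \<or> ?s (x-1) (y+1) \<or> ?s x (y+1) \<or> ?s x' y' \<or> ?s (x'-1) (y'+1) \<or> ?s x' (y'+1)"
      if xy: "(x, y) \<in> set corner_tris" "(x', y') \<in> set corner_tris" "(x, y) \<noteq> (x', y')" for x y x' y'
    proof (rule ccontr)
      assume n: "\<not> ?thesis"
      have "1 \<le> x \<and> 1 \<le> y \<and> x + y \<le> 9" "1 \<le> x' \<and> 1 \<le> y' \<and> x' + y' \<le> 9" using xy(1,2) by auto
      then have "(x, y) = c" "(x', y') = c" using single emptyI n by blast+
      then show False using xy(3) by simp
    qed
    show "\<forall>(x,y)\<in>set corner_tris. \<forall>(x',y')\<in>set corner_tris. (x, y) \<noteq> (x', y') \<longrightarrow>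
      ?s x y \<or> ?s (x-1) (y+1) \<or> ?s x (y+1) \<or> ?s x' y' \<or> ?s (x'-1) (y'+1) \<or> ?s x' (y'+1)"
      by (intro ballI case_prodI2 impI) (rule pair, simp_all only: not_False_eq_True)
    have sum8: "(\<Sum>q=1..<9. of_bool (P q)) = (of_bool (P 1) + of_bool (P 2) + of_bool (P 3) + of_bool (P 4) + of_bool (P 5) +
      of_bool (P 6) + of_bool (P 7) + of_bool (P 8) :: int)" for P :: "nat \<Rightarrow> bool"
      by (simp add: eval_nat_numeral)
    have d: "diag_cell 9 (set ps) 1 = ?s 1 9" "diag_cell 9 (set ps) 2 = ?s 2 8" "diag_cell 9 (set ps) 3 = ?s 3 7"
      "diag_cell 9 (set ps) 4 = ?s 4 6" "diag_cell 9 (set ps) 5 = ?s 5 5" "diag_cell 9 (set ps) 6 = ?s 6 4"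
      "diag_cell 9 (set ps) 7 = ?s 7 3" "diag_cell 9 (set ps) 8 = ?s 8 2" "diag_cell 9 (set ps) 9 = ?s 9 1"
      by (simp_all add: diag_cell_def)
    have S: "Suc 1 = 2" "Suc 2 = 3" "Suc 3 = 4" "Suc 4 = 5" "Suc 5 = 6" "Suc 6 = 7" "Suc 7 = 8" "Suc 8 = 9" by simp_all
    have "(\<Sum>q=1..<9. of_bool (\<not> diag_cell 9 (set ps) q \<and> diag_cell 9 (set ps) (Suc q))) = 3 + (of_bool (diag_cell 9 (set ps) 9) :: int)"
      using tr by linarith
    then show "3 + of_bool (?s 9 1) \<le> (of_bool (\<not> ?s 1 9 \<and> ?s 2 8) + of_bool (\<not> ?s 2 8 \<and> ?s 3 7) + of_bool (\<not> ?s 3 7 \<and> ?s 4 6) +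
      of_bool (\<not> ?s 4 6 \<and> ?s 5 5) + of_bool (\<not> ?s 5 5 \<and> ?s 6 4) + of_bool (\<not> ?s 6 4 \<and> ?s 7 3) + of_bool (\<not> ?s 7 3 \<and> ?s 8 2) +
      of_bool (\<not> ?s 8 2 \<and> ?s 9 1) :: int)"
      unfolding sum8 S d by (rule eq_refl[OF sym])
  qed (use crossing_path_local[OF cp] in blast)+
qed

text \<open>For length 38 the count gives r = 1 + e1 + e2, and r \<le> 4 leaves the sums 2 and 3.
  Sum 3 means r = 4, the maximum, and \<open>crossing_path_equality\<close> would make 4 odd. For
  sum 2, \<open>half_board_nine\<close> applies to the path and to its rotated image, with
  contradictory conclusions.\<close>

lemma no_crossing_path_nine:
  assumes cp: "crossing_path 9 ps"
  shows "length ps \<noteq> 38"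
proof
  assume len: "length ps = 38"
  let ?qs = "rev (map (rotate_board 9) ps)"
  have cq: "crossing_path 9 ?qs" by (rule crossing_path_rotate[OF cp])
  define e1 where "e1 = card (empty_tris 9 (set ps))"
  define e2 where "e2 = card (empty_tris 9 (rotate_board 9 ` set ps))"
  define g where "g = (\<lambda>S. (\<Sum>q=1..<9. of_bool (\<not> diag_cell 9 S q \<and> diag_cell 9 S (Suc q))) - of_bool (diag_cell 9 S 9) :: int)"
  have rr: "rotate_board 9 ` rotate_board 9 ` set ps = set ps" by (simp add: image_image)
  have pos: "e1 \<ge> 1" "e2 \<ge> 1"
    using card_empty_tris_pos[OF cp] card_empty_tris_pos[OF cq] by (simp_all add: e1_def e2_def)
  have gp: "g (set ps) = 1 + int e1 + int e2"
    using crossing_path_count[OF cp] len by (simp add: g_def e1_def e2_def)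
  have gq: "g (set ?qs) = 1 + int e1 + int e2"
    using crossing_path_count[OF cq] len by (simp add: g_def e1_def e2_def rr)
  have g4: "g (set ps) \<le> 4" using transitions_le'[of 9 "diag_cell 9 (set ps)"] by (simp add: g_def)
  show False
  proof (cases "e1 = 1 \<and> e2 = 1")
    case True
    then have 1: "g (set ps) = 3" "g (set ?qs) = 3" using gp gq by simp_all
    have Q1: "(8, 2) \<in> set ps \<and> (9, 1) \<notin> set ps \<and> (7, 3) \<notin> set ps \<and>
      ((1, 9) \<in> set ps \<or> (3, 7) \<in> set ps \<or> (4, 6) \<in> set ps \<and> (6, 4) \<notin> set ps)"
      by (rule half_board_nine[OF cp]) (use True 1(1) in \<open>simp_all only: g_def e1_def\<close>)
    have "(8, 2) \<in> set ?qs \<and> (9, 1) \<notin> set ?qs \<and> (7, 3) \<notin> set ?qs \<and>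
      ((1, 9) \<in> set ?qs \<or> (3, 7) \<in> set ?qs \<or> (4, 6) \<in> set ?qs \<and> (6, 4) \<notin> set ?qs)"
      by (rule half_board_nine[OF cq]) (use True 1(2) in \<open>simp_all only: g_def e2_def set_rev set_map\<close>)
    then have "(2, 8) \<in> set ps \<and> (1, 9) \<notin> set ps \<and> (3, 7) \<notin> set ps \<and>
      ((9, 1) \<in> set ps \<or> (7, 3) \<in> set ps \<or> (6, 4) \<in> set ps \<and> (4, 6) \<notin> set ps)"
      unfolding set_rev set_map mem_rotate_image_iff by (simp add: rotate_board_def)
    with Q1 show False by blast
  next
    case False
    then have "int e1 + int e2 = 3" using pos gp g4 by linarith
    then have "2 * int (length ps) = int 9 * int 9 - int 9 + 3 + int 4 - int e1 - int e2"
      using len by simp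
    then obtain u l where "int 4 = 2 * u - 1"
      using crossing_path_equality[OF cp _ _ _ e1_def e2_def, of 4] by auto
    then show False by presburger
  qed
qed

section \<open>Construction of long paths\<close>

text \<open>Only the cells, the ends and the length are recorded, so pieces of variable length can
  be described by inequalities instead of lists.\<close>

definition hex_path :: "cell set \<Rightarrow> cell \<Rightarrow> cell \<Rightarrow> int \<Rightarrow> bool" where
  "hex_path S p q k \<longleftrightarrow>
    (\<exists>ps. induced_path ps \<and> ps \<noteq> [] \<and> set ps = S \<and> hd ps = p \<and> last ps = q \<and> int (length ps) = k)"

text \<open>Lattice distance at most 1, as bounds in three directions that linear arithmetic can use
  directly.\<close>

definition hex_near :: "cell \<Rightarrow> cell \<Rightarrow> bool" where
  "hex_near p q \<longleftrightarrow> \<bar>fst q - fst p\<bar> \<le> 1 \<and> \<bar>snd q - snd p\<bar> \<le> 1 \<and> \<bar>fst q + snd q - (fst p + snd p)\<bar> \<le> 1"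

lemma hex_near_iff: "hex_near p q \<longleftrightarrow> q = p \<or> (p, q) \<in> hex_adj"
proof -
  have "\<bar>u\<bar> \<le> 1 \<and> \<bar>v\<bar> \<le> 1 \<and> \<bar>u + v\<bar> \<le> 1 \<longleftrightarrow>
      (u = 0 \<and> v = 0) \<or> (u, v) \<in> {(1, 0), (-1, 0), (0, 1), (0, -1), (1, -1), (-1, 1)}" (is "?l \<longleftrightarrow> ?r") for u v :: int
  proof
    assume ?l
    then have "u = -1 \<or> u = 0 \<or> u = 1" "v = -1 \<or> v = 0 \<or> v = 1" by linarith+
    then show ?r using \<open>?l\<close> by auto
  qed auto
  from this[of "fst q - fst p" "snd q - snd p"] show ?thesis
    by (cases p; cases q) (simp add: hex_near_def hex_adj_def algebra_simps)
qed

lemma hex_adj_iff_near: "(p, q) \<in> hex_adj \<longleftrightarrow> hex_near p q \<and> q \<noteq> p"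
  using hex_near_iff hex_adj_irrefl by blast

section \<open>Composition of paths from rows and columns\<close>

lemma hex_path_eq: "hex_path S p q k \<Longrightarrow> k = k' \<Longrightarrow> hex_path S p q k'"
  by simp

lemma hex_path_rev: "hex_path S p q k \<Longrightarrow> hex_path S q p k"
  unfolding hex_path_def by (metis hd_rev induced_path_rev last_rev length_rev rev_is_Nil_conv set_rev)

lemma hex_path_map:
  assumes "hex_path S p q k" "\<And>p q. (f p, f q) \<in> hex_adj \<longleftrightarrow> (p, q) \<in> hex_adj" "inj f"
  shows "hex_path (f ` S) (f p) (f q) k"
proof -
  obtain ps where "induced_path ps" "ps \<noteq> []" "set ps = S" "hd ps = p" "last ps = q" "int (length ps) = k"
    using assms(1) by (auto simp: hex_path_def)
  then show ?thesis
    unfolding hex_path_def using induced_path_map[OF _ assms(2,3)]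
    by (intro exI[of _ "map f ps"]) (auto simp: hd_map last_map)
qed

lemma hex_path_join_set:
  assumes "hex_path S p q k" "hex_path S' p' q' k'" "(q, p') \<in> hex_adj"
    and near: "\<And>x y. x \<in> S \<Longrightarrow> y \<in> S' \<Longrightarrow> hex_near x y \<Longrightarrow> x = q \<and> y = p'"
  shows "hex_path (S \<union> S') p q' (k + k')"
proof -
  obtain ps qs where ps: "induced_path ps" "ps \<noteq> []" "set ps = S" "hd ps = p" "last ps = q" "int (length ps) = k"
    and qs: "induced_path qs" "qs \<noteq> []" "set qs = S'" "hd qs = p'" "last qs = q'" "int (length qs) = k'"
    using assms(1,2) unfolding hex_path_def by (elim exE conjE) (rule that)
  have "q \<noteq> p'" using assms(3) hex_adj_irrefl by metis
  have "induced_path (ps @ qs)"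
  proof (rule induced_path_append[OF ps(1) qs(1) ps(2) qs(2)])
    show "(last ps, hd qs) \<in> hex_adj" using assms(3) ps qs by simp
    show "x \<noteq> y" if "x \<in> set ps" "y \<in> set qs" for x y
      using near[of x y] that ps(3) qs(3) \<open>q \<noteq> p'\<close> by (auto simp: hex_near_iff)
    show "x = last ps \<and> y = hd qs" if "x \<in> set ps" "y \<in> set qs" "(x, y) \<in> hex_adj" for x y
      using near[of x y] that ps qs by (simp add: hex_near_iff)
  qed
  then show ?thesis
    unfolding hex_path_def using ps qs by (intro exI[of _ "ps @ qs"]) auto
qed

text \<open>A form of \<open>hex_path_join_set\<close> whose conclusion matches the nested
  disjunction of \<open>right_arm\<close> and whose side conditions are linear.\<close>

lemma hex_path_join:
  assumes "hex_path {(x, y). P x y} p (u, v) k" "hex_path {(x, y). Q x y} (u', v') q k'"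
    and "\<bar>u' - u\<bar> \<le> 1 \<and> \<bar>v' - v\<bar> \<le> 1 \<and> \<bar>u' + v' - (u + v)\<bar> \<le> 1 \<and> (u \<noteq> u' \<or> v \<noteq> v')"
    and near: "\<And>x y x' y'. P x y \<Longrightarrow> Q x' y' \<Longrightarrow> x' - x \<le> 1 \<Longrightarrow> x - x' \<le> 1 \<Longrightarrow> y' - y \<le> 1 \<Longrightarrow> y - y' \<le> 1 \<Longrightarrow>
      x' + y' - (x + y) \<le> 1 \<Longrightarrow> x + y - (x' + y') \<le> 1 \<Longrightarrow> x = u \<and> y = v \<and> x' = u' \<and> y' = v'"
  shows "hex_path {(x, y). P x y \<or> Q x y} p q (k + k')"
proof -
  have "hex_path ({(x, y). P x y} \<union> {(x, y). Q x y}) p q (k + k')"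
  proof (rule hex_path_join_set[OF assms(1,2)])
    have "hex_near (u, v) (u', v')" using assms(3) by (simp add: hex_near_def)
    then show "((u, v), (u', v')) \<in> hex_adj" using assms(3) by (auto simp: hex_near_iff)
    show "p = (u, v) \<and> q = (u', v')" if "p \<in> {(x, y). P x y}" "q \<in> {(x, y). Q x y}" "hex_near p q" for p q
      using near[of "fst p" "snd p" "fst q" "snd q"] that by (auto simp: hex_near_def)
  qed
  moreover have "{(x, y). P x y} \<union> {(x, y). Q x y} = {(x, y). P x y \<or> Q x y}" by auto
  ultimately show ?thesis by simp
qed

lemma hex_path_single: "hex_path {(x, y). x = u \<and> y = v} (u, v) (u, v) 1"
  unfolding hex_path_def by (intro exI[of _ "[(u, v)]"]) auto

lemma hex_path_row_nat: "hex_path {(x, y). y = c \<and> l \<le> x \<and> x \<le> l + int m} (l, c) (l + int m, c) (int m + 1)"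
proof (induction m)
  case 0
  have "{(x, y). y = c \<and> l \<le> x \<and> x \<le> l + int 0} = {(x, y). x = l \<and> y = c}" by auto
  then show ?case using hex_path_single[of l c] by simp
next
  case (Suc m)
  have "hex_path {(x, y). (y = c \<and> l \<le> x \<and> x \<le> l + int m) \<or> (x = l + int m + 1 \<and> y = c)} (l, c) (l + int m + 1, c) (int m + 1 + 1)"
    by (rule hex_path_join[OF Suc hex_path_single]) auto
  moreover have "{(x, y). (y = c \<and> l \<le> x \<and> x \<le> l + int m) \<or> (x = l + int m + 1 \<and> y = c)} =
      {(x, y). y = c \<and> l \<le> x \<and> x \<le> l + int (Suc m)}" by auto
  ultimately show ?case by (simp add: algebra_simps)
qed

lemma hex_path_row: "l \<le> r \<Longrightarrow> hex_path {(x, y). y = c \<and> l \<le> x \<and> x \<le> r} (l, c) (r, c) (r - l + 1)"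
  using hex_path_row_nat[of c l "nat (r - l)"] by simp

lemma hex_path_col: "l \<le> r \<Longrightarrow> hex_path {(x, y). x = c \<and> l \<le> y \<and> y \<le> r} (c, l) (c, r) (r - l + 1)"
proof -
  assume "l \<le> r"
  have adj: "(prod.swap p, prod.swap q) \<in> hex_adj \<longleftrightarrow> (p, q) \<in> hex_adj" for p q
    by (cases p; cases q) (auto simp: hex_adj_iff)
  have "{(x, y). x = c \<and> l \<le> y \<and> y \<le> r} = prod.swap ` {(x, y). y = c \<and> l \<le> x \<and> x \<le> r}"
    by force
  then show ?thesis
    using hex_path_map[OF hex_path_row[OF \<open>l \<le> r\<close>, of c] adj] by simp
qed

text \<open>The ring of width \<open>4\<close> around a board of side \<open>N - 8\<close> carries two arms, which are exchanged by the
  rotation by 180 degrees. The inner path starts in column \<open>\<sigma>\<close> and ends in column \<open>\<tau>\<close>, in the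
  coordinates of the large board. The right arm starts at the top, runs along row \<open>2\<close> and down
  column \<open>N\<close>, goes round the corner \<open>(N, N)\<close> to column \<open>\<tau>\<close> and back, and returns by column
  \<open>N - 2\<close> and row \<open>4\<close> to the start of the inner path. The two jogs next to the corner make the turn
  there wide enough that no triangle is lost.\<close>
definition right_arm :: "int \<Rightarrow> int \<Rightarrow> int \<Rightarrow> cell set" where
  "right_arm N \<sigma> \<tau> = {(x, y).
     x = \<sigma> + 2 \<and> y = 1 \<or>
     y = 2 \<and> \<sigma> + 2 \<le> x \<and> x \<le> N \<or>
     x = N \<and> 3 \<le> y \<and> y \<le> N - 5 \<or>
     x = N - 1 \<and> N - 4 \<le> y \<and> y \<le> N - 3 \<or>
     x = N \<and> N - 3 \<le> y \<and> y \<le> N - 2 \<or>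
     y = N - 1 \<and> N - 3 \<le> x \<and> x \<le> N - 1 \<or>
     y = N - 2 \<and> N - 4 \<le> x \<and> x \<le> N - 3 \<or>
     y = N - 1 \<and> \<tau> \<le> x \<and> x \<le> N - 5 \<or>
     x = \<tau> \<and> y = N - 2 \<or>
     y = N - 3 \<and> \<tau> + 1 \<le> x \<and> x \<le> N - 5 \<or>
     y = N - 4 \<and> N - 4 \<le> x \<and> x \<le> N - 3 \<or>
     x = N - 2 \<and> 4 \<le> y \<and> y \<le> N - 5 \<or>
     y = 4 \<and> \<sigma> + 1 \<le> x \<and> x \<le> N - 3}"

lemma right_arm_path:
  assumes "1 \<le> \<sigma>" "\<sigma> \<le> N - 4" "1 \<le> \<tau>" "\<tau> \<le> N - 6" "N \<ge> 13"
  shows "hex_path (right_arm N \<sigma> \<tau>) (\<sigma> + 2, 1) (\<sigma> + 1, 4) (6 * N - 2 * \<sigma> - 2 * \<tau> - 15)"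
proof -
  note row = hex_path_row and col = hex_path_col
  note rowl = hex_path_row[THEN hex_path_rev] and coll = hex_path_col[THEN hex_path_rev]
  have l: "\<sigma> + 2 \<le> N" "3 \<le> N - 5" "N - 4 \<le> N - 3" "N - 3 \<le> N - 2" "N - 3 \<le> N - 1" "\<tau> \<le> N - 5"
    "\<tau> + 1 \<le> N - 5" "4 \<le> N - 5" "\<sigma> + 1 \<le> N - 3"
    using assms by linarith+
  show ?thesis
    unfolding right_arm_def
    \<comment> \<open>The length arises as a sum over the pieces and is compared with the stated one
      only at the end. There is one piece per disjunct, in the order of traversal;
      \<open>rowl\<close> and \<open>coll\<close> run backwards.\<close>
    apply (rule hex_path_eq)
     apply (rule hex_path_join, rule hex_path_single)
     apply (rule hex_path_join, rule row[OF l(1)])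
     apply (rule hex_path_join, rule col[OF l(2)])
     apply (rule hex_path_join, rule col[OF l(3)])
     apply (rule hex_path_join, rule col[OF l(4)])
     apply (rule hex_path_join, rule rowl[OF l(5)])
     apply (rule hex_path_join, rule rowl[OF l(3)])
     apply (rule hex_path_join, rule rowl[OF l(6)])
     apply (rule hex_path_join, rule hex_path_single)
     apply (rule hex_path_join, rule row[OF l(7)])
     apply (rule hex_path_join, rule row[OF l(3)])
     apply (rule hex_path_join, rule coll[OF l(8)])
     apply (rule rowl[OF l(9)])
    by (use assms in \<open>(simp; fail) | ((elim disjE conjE)?; (intro conjI)?; linarith)\<close>)+
qed

text \<open>The image of a right arm under the rotation of the large board. The rotation reverses
  the inner path, whose start column becomes \<open>N + 1 - \<tau>\<close> and whose end column
  becomes \<open>N + 1 - \<sigma>\<close>.\<close>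

definition left_arm :: "int \<Rightarrow> int \<Rightarrow> int \<Rightarrow> cell set" where
  "left_arm N \<sigma> \<tau> = {(x, y). (N + 1 - x, N + 1 - y) \<in> right_arm N (N + 1 - \<tau>) (N + 1 - \<sigma>)}"

lemma left_arm_path:
  assumes "7 \<le> \<sigma>" "\<sigma> \<le> N" "5 \<le> \<tau>" "\<tau> \<le> N" "N \<ge> 13"
  shows "hex_path (left_arm N \<sigma> \<tau>) (\<tau> - 1, N - 3) (\<tau> - 2, N) (2 * N + 2 * \<sigma> + 2 * \<tau> - 19)"
proof -
  let ?f = "\<lambda>p :: cell. (N + 1 - fst p, N + 1 - snd p)"
  let ?R = "right_arm N (N + 1 - \<tau>) (N + 1 - \<sigma>)"
  have "inj ?f" by (rule injI) (simp add: prod_eq_iff)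
  have adj: "(?f p, ?f q) \<in> hex_adj \<longleftrightarrow> (p, q) \<in> hex_adj" for p q
    by (auto simp: hex_adj_iff_near hex_near_def prod_eq_iff abs_le_iff)
  have "hex_path ?R (N + 1 - \<tau> + 2, 1) (N + 1 - \<tau> + 1, 4) (6 * N - 2 * (N + 1 - \<tau>) - 2 * (N + 1 - \<sigma>) - 15)"
    by (rule right_arm_path) (use assms in linarith)+
  then have path: "hex_path (?f ` ?R) (?f (N + 1 - \<tau> + 2, 1)) (?f (N + 1 - \<tau> + 1, 4)) (6 * N - 2 * (N + 1 - \<tau>) - 2 * (N + 1 - \<sigma>) - 15)"
    using adj \<open>inj ?f\<close> by (rule hex_path_map)
  have eq: "?f ` ?R = left_arm N \<sigma> \<tau>"
  proof (intro set_eqI iffI)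
    fix p assume "p \<in> ?f ` ?R"
    then obtain r where "r \<in> ?R" "p = ?f r" by blast
    then show "p \<in> left_arm N \<sigma> \<tau>" by (simp add: left_arm_def)
  next
    fix p assume "p \<in> left_arm N \<sigma> \<tau>"
    then have "?f p \<in> ?R" by (simp add: left_arm_def case_prod_unfold)
    then have "?f (?f p) \<in> ?f ` ?R" by (rule imageI)
    then show "p \<in> ?f ` ?R" by simp
  qed
  show ?thesis using hex_path_rev[OF path, unfolded eq] by (simp add: algebra_simps)
qed

lemma right_arm_left_arm_far:
  assumes "7 \<le> \<sigma>" "\<sigma> \<le> N - 4" "5 \<le> \<tau>" "\<tau> \<le> N - 6" "N \<ge> 13"
    and "p \<in> right_arm N \<sigma> \<tau>" "q \<in> left_arm N \<sigma> \<tau>"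
  shows "\<not> hex_near p q"
proof
  obtain x y u v where pq: "p = (x, y)" "q = (u, v)" by (cases p; cases q)
  assume "hex_near p q"
  then have "u - x \<le> 1" "x - u \<le> 1" "v - y \<le> 1" "y - v \<le> 1" "u + v - (x + y) \<le> 1" "x + y - (u + v) \<le> 1"
    by (auto simp: hex_near_def pq)
  with assms show False
    unfolding pq left_arm_def right_arm_def mem_Collect_eq prod.case
    by (elim disjE conjE; linarith)
qed

text \<open>The arms occupy the corners of the inner board, so the inner path has to keep away from them.\<close>
definition fits_inside :: "int \<Rightarrow> int \<Rightarrow> int \<Rightarrow> cell set \<Rightarrow> bool" where
  "fits_inside N \<sigma> \<tau> I \<longleftrightarrow> (\<forall>(x, y)\<in>I. 5 \<le> x \<and> x \<le> N - 4 \<and> 5 \<le> y \<and> y \<le> N - 4 \<and>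
     (y = 5 \<longrightarrow> x = \<sigma>) \<and> (y = N - 4 \<longrightarrow> x = \<tau>) \<and> (x, y) \<noteq> (5, 6) \<and> (x, y) \<noteq> (N - 4, N - 5))"

lemma right_arm_inside_near:
  assumes "7 \<le> \<sigma>" "\<sigma> \<le> N - 4" "5 \<le> \<tau>" "\<tau> \<le> N - 6" "N \<ge> 13"
    and "fits_inside N \<sigma> \<tau> I" "p \<in> right_arm N \<sigma> \<tau>" "q \<in> I" "hex_near p q"
  shows "p = (\<sigma> + 1, 4) \<and> q = (\<sigma>, 5)"
proof -
  obtain x y u v where pq: "p = (x, y)" "q = (u, v)" by (cases p; cases q)
  have near: "u - x \<le> 1" "x - u \<le> 1" "v - y \<le> 1" "y - v \<le> 1" "u + v - (x + y) \<le> 1" "x + y - (u + v) \<le> 1"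
    using assms(9) by (auto simp: hex_near_def pq)
  have q: "5 \<le> u" "u \<le> N - 4" "6 \<le> v \<or> v = 5 \<and> u = \<sigma>" "v \<le> N - 5 \<or> v = N - 4 \<and> u = \<tau>"
    "u \<le> N - 5 \<or> v \<le> N - 6 \<or> v \<ge> N - 4"
    using assms(6,8) by (auto simp: fits_inside_def pq)
  have "x = \<sigma> + 1 \<and> y = 4 \<and> u = \<sigma> \<and> v = 5"
    using assms(1-5,7) near q
    unfolding pq right_arm_def mem_Collect_eq prod.case
    by (elim disjE conjE; (intro conjI)?; linarith)
  then show ?thesis by (simp add: pq)
qed

text \<open>The invariant of the ring construction. The bounds on a and b and the two forbidden
  cells leave the acute corners free for the jogs of the arms, and the enlarged path satisfies them
  again.\<close>

definition extendable :: "int \<Rightarrow> cell set \<Rightarrow> int \<Rightarrow> int \<Rightarrow> int \<Rightarrow> bool" where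
  "extendable n S a b k \<longleftrightarrow> hex_path S (a, 1) (b, n) k \<and> 3 \<le> a \<and> a \<le> n \<and> 1 \<le> b \<and> b \<le> n - 2 \<and>
     (\<forall>(x, y)\<in>S. 1 \<le> x \<and> x \<le> n \<and> 1 \<le> y \<and> y \<le> n \<and> (y = 1 \<longrightarrow> x = a) \<and> (y = n \<longrightarrow> x = b) \<and>
       (x, y) \<noteq> (1, 2) \<and> (x, y) \<noteq> (n, n - 1))"

text \<open>The new path consists of the right arm, the old path shifted by (4, 4), and the left
  arm. The end columns cancel in the total length of the arms, which is 8 n + 30 and thus exactly
  B(n + 8) - B(n).\<close>

lemma extendable_step:
  assumes S: "extendable n S a b k" and n: "n \<ge> 5"
  shows "\<exists>S'. extendable (n + 8) S' (a + 6) (b + 2) (k + 8 * n + 30)"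
proof -
  define N where "N = n + 8"
  define \<sigma> where "\<sigma> = a + 4"
  define \<tau> where "\<tau> = b + 4"
  let ?g = "\<lambda>p :: cell. (fst p + 4, snd p + 4)"
  let ?I = "?g ` S"
  let ?R = "right_arm N \<sigma> \<tau>"
  let ?L = "left_arm N \<sigma> \<tau>"
  have path: "hex_path S (a, 1) (b, n) k" and ab: "3 \<le> a" "a \<le> n" "1 \<le> b" "b \<le> n - 2"
    and cells: "\<And>x y. (x, y) \<in> S \<Longrightarrow> 1 \<le> x \<and> x \<le> n \<and> 1 \<le> y \<and> y \<le> n \<and> (y = 1 \<longrightarrow> x = a) \<and> (y = n \<longrightarrow> x = b) \<and>
       (x, y) \<noteq> (1, 2) \<and> (x, y) \<noteq> (n, n - 1)"
    using S unfolding extendable_def by fast+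
  have bds: "7 \<le> \<sigma>" "\<sigma> \<le> N - 4" "5 \<le> \<tau>" "\<tau> \<le> N - 6" "N \<ge> 13"
    using ab n by (auto simp: N_def \<sigma>_def \<tau>_def)
  have bds': "7 \<le> N + 1 - \<tau>" "N + 1 - \<tau> \<le> N - 4" "5 \<le> N + 1 - \<sigma>" "N + 1 - \<sigma> \<le> N - 6"
    using bds by linarith+
  have R: "hex_path ?R (\<sigma> + 2, 1) (\<sigma> + 1, 4) (6 * N - 2 * \<sigma> - 2 * \<tau> - 15)"
    by (rule right_arm_path) (use bds in linarith)+
  have L: "hex_path ?L (\<tau> - 1, N - 3) (\<tau> - 2, N) (2 * N + 2 * \<sigma> + 2 * \<tau> - 19)"
    by (rule left_arm_path) (use bds in linarith)+
  have "hex_path ?I (?g (a, 1)) (?g (b, n)) k"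
  proof (rule hex_path_map[OF path])
    show "(?g p, ?g q) \<in> hex_adj \<longleftrightarrow> (p, q) \<in> hex_adj" for p q
      by (auto simp: hex_adj_iff_near hex_near_def prod_eq_iff abs_le_iff)
    show "inj ?g" by (auto simp: inj_on_def)
  qed
  moreover have "?g (a, 1) = (\<sigma>, 5)" "?g (b, n) = (\<tau>, N - 4)" by (simp_all add: \<sigma>_def \<tau>_def N_def)
  ultimately have I: "hex_path ?I (\<sigma>, 5) (\<tau>, N - 4) k" by (simp only:)
  have fits: "fits_inside N \<sigma> \<tau> ?I"
    using cells by (fastforce simp: fits_inside_def N_def \<sigma>_def \<tau>_def)
  \<comment> \<open>The rotated inner path fits too, with its ends exchanged, so
    \<open>right_arm_inside_near\<close> also settles the contact with the left arm.\<close>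
  have fits': "fits_inside N (N + 1 - \<tau>) (N + 1 - \<sigma>) {(x, y). (N + 1 - x, N + 1 - y) \<in> ?I}"
    using fits by (fastforce simp: fits_inside_def)
  have RI: "hex_path (?R \<union> ?I) (\<sigma> + 2, 1) (\<tau>, N - 4) (6 * N - 2 * \<sigma> - 2 * \<tau> - 15 + k)"
  proof (rule hex_path_join_set[OF R I])
    show "((\<sigma> + 1, 4), (\<sigma>, 5)) \<in> hex_adj" by (simp add: hex_adj_iff)
    show "p = (\<sigma> + 1, 4) \<and> q = (\<sigma>, 5)" if "p \<in> ?R" "q \<in> ?I" "hex_near p q" for p q
      using right_arm_inside_near[OF bds fits that] .
  qed
  have "hex_path (?R \<union> ?I \<union> ?L) (\<sigma> + 2, 1) (\<tau> - 2, N)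
    (6 * N - 2 * \<sigma> - 2 * \<tau> - 15 + k + (2 * N + 2 * \<sigma> + 2 * \<tau> - 19))"
  proof (rule hex_path_join_set[OF RI L])
    show "((\<tau>, N - 4), (\<tau> - 1, N - 3)) \<in> hex_adj" by (simp add: hex_adj_iff)
    fix p q assume p: "p \<in> ?R \<union> ?I" and q: "q \<in> ?L" and near: "hex_near p q"
    have "p \<notin> ?R" using right_arm_left_arm_far[OF bds _ q] near by blast
    then have p: "p \<in> ?I" using p by blast
    obtain x y u v where pq: "p = (x, y)" "q = (u, v)" by (cases p; cases q)
    have "(N + 1 - u, N + 1 - v) = (N + 1 - \<tau> + 1, 4) \<and> (N + 1 - x, N + 1 - y) = (N + 1 - \<tau>, 5)"
    proof (rule right_arm_inside_near[OF bds' bds(5) fits'])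
      show "(N + 1 - u, N + 1 - v) \<in> right_arm N (N + 1 - \<tau>) (N + 1 - \<sigma>)"
        using q by (simp add: pq left_arm_def)
      show "(N + 1 - x, N + 1 - y) \<in> {(x, y). (N + 1 - x, N + 1 - y) \<in> ?I}"
        using p by (simp add: pq)
      show "hex_near (N + 1 - u, N + 1 - v) (N + 1 - x, N + 1 - y)"
        using near by (simp add: pq hex_near_def, linarith)
    qed
    then show "p = (\<tau>, N - 4) \<and> q = (\<tau> - 1, N - 3)" by (auto simp: pq)
  qed
  then have P: "hex_path (?R \<union> ?I \<union> ?L) (a + 6, 1) (b + 2, n + 8) (k + 8 * n + 30)"
    by (simp add: \<sigma>_def \<tau>_def N_def algebra_simps)
  \<comment> \<open>Stated for arbitrary end columns, since the left arm uses it after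
    rotation.\<close>
  have cellsR: "1 \<le> x \<and> x \<le> N \<and> 1 \<le> y \<and> y \<le> N - 1 \<and> (y = 1 \<longrightarrow> x = \<sigma> + 2) \<and> (x = 1 \<longrightarrow> y \<noteq> 2) \<and> (x = N \<longrightarrow> y \<noteq> N - 1)"
    if "(x, y) \<in> right_arm N \<sigma> \<tau>" "7 \<le> \<sigma>" "\<sigma> \<le> N - 4" "5 \<le> \<tau>" "\<tau> \<le> N - 6" for x y \<sigma> \<tau>
    using that bds(5) unfolding right_arm_def mem_Collect_eq prod.case
    by (elim disjE conjE) auto
  have U: "1 \<le> x \<and> x \<le> N \<and> 1 \<le> y \<and> y \<le> N \<and> (y = 1 \<longrightarrow> x = \<sigma> + 2) \<and> (y = N \<longrightarrow> x = \<tau> - 2) \<and>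
       (x, y) \<noteq> (1, 2) \<and> (x, y) \<noteq> (N, N - 1)" if "(x, y) \<in> ?R \<union> ?I \<union> ?L" for x y
    using that
  proof (elim UnE)
    assume "(x, y) \<in> ?R"
    from cellsR[OF this bds(1-4)] show ?thesis by auto
  next
    assume "(x, y) \<in> ?I"
    then show ?thesis using fits bds by (fastforce simp: fits_inside_def)
  next
    assume "(x, y) \<in> ?L"
    then have "(N + 1 - x, N + 1 - y) \<in> right_arm N (N + 1 - \<tau>) (N + 1 - \<sigma>)" by (simp add: left_arm_def)
    from cellsR[OF this bds'] show ?thesis by auto
  qed
  have "\<forall>(x, y)\<in>?R \<union> ?I \<union> ?L. 1 \<le> x \<and> x \<le> n + 8 \<and> 1 \<le> y \<and> y \<le> n + 8 \<and>
      (y = 1 \<longrightarrow> x = a + 6) \<and> (y = n + 8 \<longrightarrow> x = b + 2) \<and> (x, y) \<noteq> (1, 2) \<and> (x, y) \<noteq> (n + 8, n + 8 - 1)"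
  proof (rule ballI, rule case_prodI2)
    fix p x y assume "p \<in> ?R \<union> ?I \<union> ?L" "p = (x, y)"
    then have "(x, y) \<in> ?R \<union> ?I \<union> ?L" by (simp only:)
    from U[OF this] show "1 \<le> x \<and> x \<le> n + 8 \<and> 1 \<le> y \<and> y \<le> n + 8 \<and>
      (y = 1 \<longrightarrow> x = a + 6) \<and> (y = n + 8 \<longrightarrow> x = b + 2) \<and> (x, y) \<noteq> (1, 2) \<and> (x, y) \<noteq> (n + 8, n + 8 - 1)"
      by (auto simp: N_def \<sigma>_def \<tau>_def)
  qed
  moreover have "3 \<le> a + 6" "a + 6 \<le> n + 8" "1 \<le> b + 2" "b + 2 \<le> n + 8 - 2" using ab by linarith+
  ultimately have "extendable (n + 8) (?R \<union> ?I \<union> ?L) (a + 6) (b + 2) (k + 8 * n + 30)"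
    unfolding extendable_def using P by blast
  then show ?thesis by blast
qed

text \<open>Paths are stored by their turning points. A segment stops one cell short of its end,
  because the next segment begins there. The checks below run on the expanded list.\<close>

fun polyline :: "cell list \<Rightarrow> cell list" where
  "polyline (p # q # ps) =
     map (\<lambda>i. (fst p + i * sgn (fst q - fst p), snd p + i * sgn (snd q - snd p)))
       [0..max \<bar>fst q - fst p\<bar> \<bar>snd q - snd p\<bar> - 1] @ polyline (q # ps)"
| "polyline ps = ps"

text \<open>Executable counterpart of \<open>induced_path\<close>, with the arithmetic test
  \<open>hex_near\<close> in place of the set \<open>hex_adj\<close>.\<close>

fun induced_check :: "cell list \<Rightarrow> bool" where
  "induced_check (p # q # ps) \<longleftrightarrow> hex_near p q \<and> p \<noteq> q \<and> list_all (\<lambda>r. \<not> hex_near p r) ps \<and> induced_check (q # ps)"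
| "induced_check ps \<longleftrightarrow> True"

lemma induced_check_imp: "induced_check ps \<Longrightarrow> induced_path ps"
  by (induction ps rule: induced_check.induct) (auto simp: hex_near_iff list_all_iff)

definition base_check :: "int \<Rightarrow> cell list \<Rightarrow> int \<Rightarrow> int \<Rightarrow> int \<Rightarrow> bool" where
  "base_check n ps a b k \<longleftrightarrow> induced_check ps \<and> ps \<noteq> [] \<and> hd ps = (a, 1) \<and> last ps = (b, n) \<and> int (length ps) = k \<and>
     3 \<le> a \<and> a \<le> n \<and> 1 \<le> b \<and> b \<le> n - 2 \<and>
     list_all (\<lambda>(x, y). 1 \<le> x \<and> x \<le> n \<and> 1 \<le> y \<and> y \<le> n \<and> (y = 1 \<longrightarrow> x = a) \<and> (y = n \<longrightarrow> x = b) \<and>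
       (x, y) \<noteq> (1, 2) \<and> (x, y) \<noteq> (n, n - 1)) ps"

lemma base_check_extendable: "base_check n ps a b k \<Longrightarrow> extendable n (set ps) a b k"
  unfolding base_check_def extendable_def hex_path_def list_all_iff
  by (intro conjI exI[of _ ps]; elim conjE; (erule induced_check_imp)?; assumption?) simp_all

text \<open>The following paths were found by computer search. The case \<open>n = 17\<close> is needed because
  \<open>n = 9\<close> is an exception.\<close>
lemma extendable_5: "\<exists>S. extendable 5 S 5 1 11"
proof -
  have "base_check 5 (polyline [(5, 1), (5, 3), (4, 4), (3, 4), (3, 2), (2, 2), (1, 3), (1, 5)])
    5 1 11"
    by code_simp
  then show ?thesis by (blast dest: base_check_extendable)
qed

lemma extendable_6: "\<exists>S. extendable 6 S 6 2 16"
proof -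
  have "base_check 6 (polyline [(6, 1), (6, 4), (5, 5), (4, 5), (4, 2), (2, 2), (1, 3), (1, 4), (2, 4), (2, 6)])
    6 2 16"
    by code_simp
  then show ?thesis by (blast dest: base_check_extendable)
qed

lemma extendable_7: "\<exists>S. extendable 7 S 5 3 23"
proof -
  have "base_check 7 (polyline [(5, 1), (5, 2), (7, 2), (7, 5), (6, 6), (5, 6), (5, 4), (3, 4), (3, 2), (2, 2), (1, 3), (1, 6), (3,
    6), (3, 7)])
    5 3 23"
    by code_simp
  then show ?thesis by (blast dest: base_check_extendable)
qed

lemma extendable_8: "\<exists>S. extendable 8 S 5 3 30"
proof -
  have "base_check 8 (polyline [(5, 1), (5, 2), (8, 2), (8, 6), (7, 7), (6, 7), (6, 4), (3, 4), (3, 2), (2, 2), (1, 3), (1, 7), (2,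
    7), (3, 6), (4, 6), (4, 7), (3, 8)])
    5 3 30"
    by code_simp
  then show ?thesis by (blast dest: base_check_extendable)
qed

lemma extendable_10: "\<exists>S. extendable 10 S 3 3 47"
proof -
  have "base_check 10 (polyline [(3, 1), (1, 3), (1, 6), (2, 6), (2, 7), (1, 8), (1, 9), (2, 9), (4, 7), (5, 7), (6, 6), (7, 6), (8,
    5), (8, 4), (6, 4), (5, 5), (4, 5), (4, 4), (3, 4), (3, 3), (4, 2), (10, 2), (10, 5), (9, 6), (9,
    7), (10, 7), (10, 8), (9, 9), (7, 9), (7, 8), (6, 8), (5, 9), (4, 9), (3, 10)])
    3 3 47"
    by code_simp
  then show ?thesis by (blast dest: base_check_extendable)
qed

lemma extendable_11: "\<exists>S. extendable 11 S 5 1 57"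
proof -
  have "base_check 11 (polyline [(5, 1), (5, 2), (6, 2), (6, 3), (7, 3), (8, 2), (11, 2), (11, 5), (10, 6), (10, 7), (11, 7), (11,
    9), (10, 10), (9, 10), (9, 9), (8, 9), (7, 10), (4, 10), (4, 9), (3, 9), (3, 8), (4, 7), (6, 7), (6,
    8), (7, 8), (8, 7), (8, 6), (9, 5), (9, 4), (8, 4), (7, 5), (4, 5), (4, 4), (3, 4), (3, 2), (2, 2),
    (1, 3), (1, 6), (2, 6), (2, 7), (1, 8), (1, 11)])
    5 1 57"
    by code_simp
  then show ?thesis by (blast dest: base_check_extendable)
qed

lemma extendable_12: "\<exists>S. extendable 12 S 5 8 69"
proof -
  have "base_check 12 (polyline [(5, 1), (5, 2), (6, 2), (6, 3), (7, 3), (8, 2), (12, 2), (12, 5), (11, 6), (11, 7), (12, 7), (12,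
    10), (11, 11), (10, 11), (10, 9), (9, 9), (9, 8), (8, 8), (7, 9), (3, 9), (3, 8), (4, 7), (7, 7),
    (8, 6), (9, 6), (10, 5), (10, 4), (8, 4), (7, 5), (4, 5), (4, 4), (3, 4), (3, 2), (2, 2), (1, 3),
    (1, 6), (2, 6), (2, 7), (1, 8), (1, 11), (8, 11), (8, 12)])
    5 8 69"
    by code_simp
  then show ?thesis by (blast dest: base_check_extendable)
qed

lemma extendable_17: "\<exists>S. extendable 17 S 14 13 140"
proof -
  have "base_check 17 (polyline [(14, 1), (14, 2), (17, 2), (17, 5), (16, 6), (16, 7), (17, 7), (17, 15), (16, 16), (15, 16), (15,
    14), (14, 14), (14, 13), (15, 12), (15, 9), (14, 9), (14, 8), (13, 8), (12, 9), (11, 9), (10, 10),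
    (7, 10), (7, 6), (6, 6), (5, 7), (5, 12), (10, 12), (11, 11), (13, 11), (13, 12), (12, 13), (11,
    13), (10, 14), (3, 14), (3, 7), (4, 6), (4, 5), (5, 4), (9, 4), (9, 8), (10, 8), (11, 7), (12, 7),
    (13, 6), (14, 6), (15, 5), (15, 4), (13, 4), (12, 5), (11, 5), (11, 4), (12, 3), (12, 2), (5, 2),
    (4, 3), (3, 3), (3, 2), (2, 2), (1, 3), (1, 5), (2, 5), (2, 6), (1, 7), (1, 16), (10, 16), (11, 15),
    (12, 15), (12, 16), (13, 16), (13, 17)])
    14 13 140"
    by code_simp
  then show ?thesis by (blast dest: base_check_extendable)
qed

lemma extendable_crossing_path:
  assumes "extendable (int n) S a b k"
  obtains ps where "crossing_path n ps" "set ps = S" "int (length ps) = k"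
proof -
  obtain ps where ps: "induced_path ps" "ps \<noteq> []" "set ps = S" "hd ps = (a, 1)" "last ps = (b, int n)" "int (length ps) = k"
    using assms unfolding extendable_def hex_path_def by (elim conjE exE) (rule that)
  have "1 \<le> x \<and> x \<le> int n \<and> 1 \<le> y \<and> y \<le> int n \<and> (y = 1 \<longrightarrow> x = a) \<and> (y = int n \<longrightarrow> x = b)"
    if "(x, y) \<in> S" for x y
    using assms that unfolding extendable_def by fast
  then have "crossing_path n ps"
    using ps unfolding crossing_path_def hex_board_def by (auto simp: prod_eq_iff)
  then show thesis using that ps by blast
qed

text \<open>Induction in steps of 8, where the path and the bound grow by the same amount. Side 17
  would rest on the exceptional side 9 and is a base case instead; every other n \<ge> 13 reduces to
  n - 8, which is at least 5 and not 9.\<close>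

lemma extendable_exists:
  assumes "n \<ge> 5" "n \<noteq> 9"
  shows "\<exists>S a b k. extendable (int n) S a b k \<and> 4 * k = hex_bound4 n"
  using assms
proof (induction n rule: less_induct)
  case (less n)
  consider "n = 5" | "n = 6" | "n = 7" | "n = 8" | "n = 10" | "n = 11" | "n = 12" | "n = 17" | "n \<ge> 13" "n \<noteq> 17"
    using less.prems by linarith
  then show ?case
  proof cases
    case 9
    define m where "m = n - 8"
    have m: "n = m + 8" "m \<ge> 5" "m \<noteq> 9" "m < n" using 9 by (auto simp: m_def)
    obtain S a b k where S: "extendable (int m) S a b k" "4 * k = hex_bound4 m"
      using less.IH[OF m(4,2,3)] by blast
    have "hex_bound4 n = hex_bound4 m + 32 * int m + 120"
    proof -
      have "n mod 4 = m mod 4" "n mod 8 = m mod 8" unfolding m(1) by presburger+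
      moreover have "int n * int n = int m * int m + 16 * int m + 64" by (simp add: m(1) algebra_simps)
      ultimately show ?thesis by (simp add: hex_bound4_def m(1))
    qed
    then have "4 * (k + 8 * int m + 30) = hex_bound4 n" using S(2) by simp
    moreover obtain S' where "extendable (int m + 8) S' (a + 6) (b + 2) (k + 8 * int m + 30)"
      using extendable_step[OF S(1)] m(2) by auto
    then have "extendable (int n) S' (a + 6) (b + 2) (k + 8 * int m + 30)" using m(1) by simp
    ultimately show ?thesis by blast
  qed (use extendable_5 extendable_6 extendable_7 extendable_8 extendable_10 extendable_11 extendable_12 extendable_17
    in \<open>force simp: hex_bound4_def\<close>)+
qed

theorem theorem5:
  shows "(\<forall>n\<ge>5. \<forall>S. winning_path n S \<longrightarrow> real (card S) \<le> hex_bound n)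
    \<and> (\<forall>n\<ge>5. n \<noteq> 9 \<longrightarrow> (\<exists>S. winning_path n S \<and> real (card S) = hex_bound n))
    \<and> hex_bound 9 = 38
    \<and> \<not> (\<exists>S. winning_path 9 S \<and> real (card S) = hex_bound 9)"
proof (intro conjI allI impI)
  have card: "card (set ps) = length ps" if "crossing_path n ps" for n ps
    using that induced_path_distinct distinct_card by (auto simp: crossing_path_def)
  show "real (card S) \<le> hex_bound n" if n: "5 \<le> n" and S: "winning_path n S" for n S
  proof -
    obtain ps where ps: "crossing_path n ps" "set ps = S" using winning_path_obtains_list[OF S] .
    have "real_of_int (4 * int (length ps)) \<le> real_of_int (hex_bound4 n)"
      using crossing_path_length_upper[OF ps(1) n] by (simp only: of_int_le_iff)
    then show ?thesis using card[OF ps(1)] ps(2) by (simp add: hex_bound_conv)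
  qed
  show "\<exists>S. winning_path n S \<and> real (card S) = hex_bound n" if n: "5 \<le> n" "n \<noteq> 9" for n
  proof -
    obtain S a b k where S: "extendable (int n) S a b k" "4 * k = hex_bound4 n"
      using extendable_exists[OF n] by blast
    obtain ps where ps: "crossing_path n ps" "set ps = S" "int (length ps) = k"
      using extendable_crossing_path[OF S(1)] .
    have "hex_bound n = real (length ps)"
      unfolding hex_bound_conv S(2)[symmetric] ps(3)[symmetric] by simp
    then show ?thesis using winning_path_of_list[OF ps(1)] card[OF ps(1)] by auto
  qed
  show nine: "hex_bound 9 = 38" by (simp add: hex_bound_def)
  show "\<not> (\<exists>S. winning_path 9 S \<and> real (card S) = hex_bound 9)"
  proof (intro notI, elim exE conjE)
    fix S assume S: "winning_path 9 S" "real (card S) = hex_bound 9"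
    obtain ps where ps: "crossing_path 9 ps" "set ps = S" using winning_path_obtains_list[OF S(1)] .
    then have "length ps = 38" using card[OF ps(1)] S(2) nine by simp
    then show False using no_crossing_path_nine[OF ps(1)] by simp
  qed
qed

end
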